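(* There exist positive functions $\delta=\delta(\alpha,\beta)$ and $\Delta=\Delta(\alpha,\beta)$, defined for all real $\alpha,\beta>0$ with $2\alpha+\beta<1$ and satisfying $\delta(\alpha,\beta)\to 1/23$ and $\Delta(\alpha,\beta)\to 23$ as $\alpha,\beta\to 0$, such that the following holds. Let $\alpha,\beta>0$ with $2\alpha+\beta<1$, let $n$ be a positive integer, let $P$ be a partial Latin square of order $n$ with $|\mathcal{R}_P|\le \alpha n$ and $|\mathcal{C}_P|\le \beta n$, and let $\mathbf{L}$ be a random Latin square of order $n$. Then \[ \left(\frac{\delta}{n}\right)^{|P|}\le \mathbb{P}(\mathbf{L}\supseteq P)\le \left(\frac{\Delta}{n}\right)^{|P|}. \]
   Context: A partial Latin square of order $n$ is an $n\times n$ matrix (rows, columns and symbols indexed by $[n]=\{1,\dots,n\}$) in which each cell is either empty or filled with one of the $n$ symbols, with no symbol repeated in any row or column. A Latin square is a partial Latin square with every cell filled. A partial Latin square $P$ is identified with its set of entries, i.e. the triples $(r,c,s)$ such that cell $(r,c)$ contains symbol $s$; thus $|P|$ is the number of non-empty cells, and $L\supseteq P$ means the Latin square $L$ contains every entry of $P$. $\mathcal{R}_P$ and $\mathcal{C}_P$ denote the sets of rows and columns, respectively, containing a non-empty cell of $P$. A random Latin square of order $n$ is chosen uniformly from all Latin squares of order $n$ on rows, columns and symbols $[n]$. *)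

theory Defs
  imports "HOL-Probability.Probability" "HOL-Number_Theory.Cong"
begin

text \<open>A partial Latin square of order \<open>n\<close> is represented by its set of entries: the triples
  \<open>(r, c, s)\<close> such that the cell in row \<open>r\<close> and column \<open>c\<close> contains the symbol \<open>s\<close>.\<close>

type_synonym entry = "nat \<times> nat \<times> nat"

definition partial_latin_square :: "nat \<Rightarrow> entry set \<Rightarrow> bool" where
  "partial_latin_square n P \<longleftrightarrow>
     P \<subseteq> {1..n} \<times> {1..n} \<times> {1..n} \<and>
     (\<forall>r c s s'. (r, c, s) \<in> P \<longrightarrow> (r, c, s') \<in> P \<longrightarrow> s = s') \<and>
     (\<forall>r c c' s. (r, c, s) \<in> P \<longrightarrow> (r, c', s) \<in> P \<longrightarrow> c = c') \<and>
     (\<forall>r r' c s. (r, c, s) \<in> P \<longrightarrow> (r', c, s) \<in> P \<longrightarrow> r = r')"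

definition latin_square :: "nat \<Rightarrow> entry set \<Rightarrow> bool" where
  "latin_square n L \<longleftrightarrow>
     partial_latin_square n L \<and> (\<forall>r\<in>{1..n}. \<forall>c\<in>{1..n}. \<exists>s. (r, c, s) \<in> L)"

definition rows_of :: "entry set \<Rightarrow> nat set" where
  "rows_of P = {r. \<exists>c s. (r, c, s) \<in> P}"

definition cols_of :: "entry set \<Rightarrow> nat set" where
  "cols_of P = {c. \<exists>r s. (r, c, s) \<in> P}"

definition random_latin_square :: "nat \<Rightarrow> entry set pmf" where
  "random_latin_square n = pmf_of_set {L. latin_square n L}"

text \<open>\<open>pmf_of_set\<close> is the uniform distribution only on finite nonempty sets.\<close>

lemma finite_latin_squares: "finite {L. latin_square n L}"
  by (rule finite_subset[of _ "Pow ({1..n} \<times> {1..n} \<times> {1..n})"])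
     (auto simp: latin_square_def partial_latin_square_def)

lemma latin_squares_nonempty: "{L. latin_square n L} \<noteq> {}"
proof -
  let ?L = "{(r, c, Suc ((r + c) mod n)) | r c. r \<in> {1..n} \<and> c \<in> {1..n}}"
  have inj: "c = c'"
    if "c \<in> {1..n}" "c' \<in> {1..n}" "(r + c) mod n = (r + c') mod n" for r c c' :: nat
  proof -
    have "[c = c'] (mod n)"
      using that(3) by (simp only: cong_def[symmetric] cong_add_lcancel_nat)
    hence m: "c mod n = c' mod n" by (simp only: cong_def)
    have "x mod n = (if x = n then 0 else x)" if "x \<in> {1..n}" for x
      using that by simp
    from this[OF that(1)] this[OF that(2)] m that(1,2) show ?thesis
      by (simp split: if_splits)
  qed
  have inj': "r = r'"
    if "r \<in> {1..n}" "r' \<in> {1..n}" "(r + c) mod n = (r' + c) mod n" for r r' c :: nat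
    using inj[of r r' c] that by (simp add: add.commute)
  have "latin_square n ?L"
    unfolding latin_square_def partial_latin_square_def
  proof (intro conjI)
    show "?L \<subseteq> {1..n} \<times> {1..n} \<times> {1..n}" by (auto simp: Suc_le_eq)
    show "\<forall>r c s s'. (r, c, s) \<in> ?L \<longrightarrow> (r, c, s') \<in> ?L \<longrightarrow> s = s'" by blast
    show "\<forall>r c c' s. (r, c, s) \<in> ?L \<longrightarrow> (r, c', s) \<in> ?L \<longrightarrow> c = c'"
      using inj by blast
    show "\<forall>r r' c s. (r, c, s) \<in> ?L \<longrightarrow> (r', c, s) \<in> ?L \<longrightarrow> r = r'"
      using inj' by blast
    show "\<forall>r\<in>{1..n}. \<forall>c\<in>{1..n}. \<exists>s. (r, c, s) \<in> ?L" by blast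
  qed
  thus ?thesis by blast
qed

end

theory Submission
  imports Defs
begin

text \<open>
  Let \<open>R\<close> and \<open>C\<close> be the rows and columns met by \<open>P\<close>, and let \<open>\<gamma> = 1 - 2\<alpha> - \<beta>\<close>, which is at most the
  proportion of \<open>n\<close> left over by \<open>2 |R| + |C|\<close>.  The entries of \<open>P\<close> are added one at a time: for
  \<open>Q \<subset> P\<close> and an entry \<open>(r, c, s)\<close> of \<open>P\<close> outside \<open>Q\<close>, the number of Latin squares containing \<open>Q\<close> and
  the number of those containing also \<open>(r, c, s)\<close> differ by a factor of order \<open>n\<close>, within constants
  depending on \<open>\<alpha>\<close> and \<open>\<beta>\<close> only (\<open>entry_bounds\<close>).  As \<open>\<alpha>\<close> and \<open>\<beta>\<close> tend to 0 these constants tend to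
  \<open>18\<close> and \<open>19\<close>, which leaves room for \<open>23\<close>.

  \<^bold>\<open>The switching.\<close>  Choose a column \<open>e\<close> outside \<open>C\<close> and exchange the symbols \<open>p\<close>, \<open>q\<close> in the cells
  \<open>(r, c)\<close>, \<open>(r, e)\<close>.  Now column \<open>c\<close> has \<open>q\<close> twice and lacks \<open>p\<close>, column \<open>e\<close> has \<open>p\<close> twice and lacks \<open>q\<close>.
  Let \<open>a\<close> be the other row with \<open>q\<close> in column \<open>c\<close> and \<open>b\<close> the other row with \<open>p\<close> in column \<open>e\<close>.  For all but
  \<open>|C| + 2|R|\<close> choices of \<open>e\<close> both lie outside \<open>R\<close>, so they may be rearranged freely.  Join two columns
  if some symbol occurs in one of them in row \<open>a\<close> and in the other in row \<open>b\<close>; this decomposes the columns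
  into cycles.  If \<open>c\<close> and \<open>e\<close> lie on the same cycle, exchanging rows \<open>a\<close> and \<open>b\<close> along a path from \<open>c\<close> to \<open>e\<close>
  repairs the square, and this can be undone, because \<open>a\<close> and \<open>b\<close> can be read off from the result.  If they
  lie on different cycles, exchanging \<open>a\<close> and \<open>b\<close> on the cycle of \<open>e\<close> moves both \<open>p\<close> and \<open>q\<close> into row \<open>a\<close>;
  then rows \<open>r\<close>, \<open>a\<close> and columns \<open>c\<close>, \<open>e\<close> form an intercalate (a subsquare of order 2), which is turned over.
  This second case forgets \<open>b\<close>, so it is up to \<open>n\<close>-to-one, but its results all contain an intercalate
  through the cell \<open>(r, c)\<close> (\<open>switch_bound\<close>).

  \<^bold>\<open>Intercalates are rare.\<close>  It therefore suffices that only a proportion of order \<open>1/n\<close> of the squares in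
  question have such an intercalate (\<open>card_intercalates\<close>).  Let its rows be \<open>r\<close>, \<open>b\<close> and its columns
  \<open>c\<close>, \<open>e\<close>, and let \<open>w\<close> be the symbol of the cell \<open>(b, e)\<close>.  For each column \<open>k\<close> outside \<open>C\<close>
  one tries to move \<open>w\<close> within row \<open>b\<close> from \<open>e\<close> to \<open>k\<close>; squares with \<open>w\<close> in different cells \<open>(b, k)\<close> are
  distinct, and the result reveals \<open>k\<close>, so a bounded number of preimages for each \<open>k\<close> is enough.  Join rows by
  symbols common to columns \<open>e\<close> and \<open>k\<close>, as above with rows and columns interchanged.
  If \<open>r\<close> and \<open>b\<close> are on different cycles, exchange \<open>e\<close> and \<open>k\<close> on the cycle of \<open>b\<close>.
  If they are on the same cycle, one tries to cut it at two rows outside \<open>R\<close>, one on either arc between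
  \<open>b\<close> and \<open>r\<close>: either the cut is possible and separates \<open>r\<close> from \<open>b\<close>, or what prevents it
  allows the columns to be exchanged on the part around \<open>b\<close>, with a repair as above, which also moves
  \<open>w\<close> to column \<open>k\<close>.  One end of the cut is next to \<open>b\<close> and the other is arbitrary, so there are as many cuts as rows
  outside \<open>R\<close> on the cycle, while a result has at most \<open>|U - R|\<close> preimages (\<open>card_cuts\<close>).  Cycles with
  few cuts are not a problem on average: joining another cycle to such a cycle is always possible, and
  each joined row provides a cut of the result, so there are at most twice as many joins as cuts
  (\<open>card_joins\<close>).  Every row outside \<open>R\<close> other than \<open>b\<close> and its neighbour gives a cut or a join
  (\<open>linked_cover\<close>), which bounds the number of squares with \<open>r\<close> and \<open>b\<close> on the same cycle.

  \<^bold>\<open>The two bounds.\<close>  Switching \<open>s\<close> out of \<open>(r, c)\<close> gives the upper bound (\<open>cell_upper\<close>).  Switching \<open>s\<close>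
  into \<open>(r, c)\<close> requires \<open>s\<close> to occur in column \<open>c\<close> outside \<open>R\<close>, in row \<open>r\<close> outside \<open>C\<close>, and the displaced symbol
  to be outside \<open>R\<close> in the column it is moved to (\<open>cell_lower\<close>); each of these fails for a bounded multiple
  of the squares where it holds, by the upper bound applied to the cell that is in the way
  (\<open>card_F\<close>, \<open>card_N1\<close>, \<open>card_N2\<close>).
\<close>

section \<open>Two bijections of a finite set\<close>

locale index_set =
  fixes U :: "nat set"
  assumes fin: "finite U"
begin

text \<open>Rows and columns of a Latin square, as maps from positions to symbols. Everything below about a pair of
  rows is used for a pair of columns as well, by transposition.\<close>
definition line :: "(nat \<Rightarrow> nat) \<Rightarrow> bool" where
  "line f \<longleftrightarrow> bij_betw f U U"

text \<open>Draw an edge between positions \<open>u\<close> and \<open>v\<close> if \<open>f u = g v\<close>. This gives a union of cycles, and a closed set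
  is a union of some of them. Working with such sets of positions instead of with cyclic orders
  turns all arguments about cycles into identities between images.\<close>
definition closed_set :: "(nat \<Rightarrow> nat) \<Rightarrow> (nat \<Rightarrow> nat) \<Rightarrow> nat set \<Rightarrow> bool" where
  "closed_set f g Z \<longleftrightarrow> Z \<subseteq> U \<and> f ` Z = g ` Z"

definition component :: "(nat \<Rightarrow> nat) \<Rightarrow> (nat \<Rightarrow> nat) \<Rightarrow> nat \<Rightarrow> nat set" where
  "component f g u = \<Inter>{Z. closed_set f g Z \<and> u \<in> Z}"

text \<open>The least such \<open>K\<close> is the interior of the path on a cycle that leads from the position with \<open>f\<close>-symbol \<open>s\<close> to the
  position with \<open>g\<close>-symbol \<open>t\<close>. A general bridge may contain further cycles. Exchanging \<open>f\<close> and \<open>g\<close> on \<open>K\<close> is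
  what has to accompany the replacement of \<open>s\<close> by \<open>t\<close> in \<open>f\<close> and of \<open>t\<close> by \<open>s\<close> in \<open>g\<close>.\<close>
definition bridge :: "(nat \<Rightarrow> nat) \<Rightarrow> (nat \<Rightarrow> nat) \<Rightarrow> nat \<Rightarrow> nat \<Rightarrow> nat set \<Rightarrow> bool" where
  "bridge f g s t K \<longleftrightarrow>
     K \<subseteq> U \<and> s \<notin> f ` K \<and> t \<notin> g ` K \<and> insert s (f ` K) = insert t (g ` K)"

text \<open>The least bridge, like the least closed set containing a point, is the same before and after
  an exchange. This is what makes the moves involutive.\<close>
definition least_bridge :: "(nat \<Rightarrow> nat) \<Rightarrow> (nat \<Rightarrow> nat) \<Rightarrow> nat \<Rightarrow> nat \<Rightarrow> nat set" where
  "least_bridge f g s t = \<Inter>{K. bridge f g s t K}"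

lemma line_iff: "line f \<longleftrightarrow> inj_on f U \<and> f ` U \<subseteq> U"
  unfolding line_def bij_betw_def using fin endo_inj_surj by auto

lemma line_mem: "line f \<Longrightarrow> u \<in> U \<Longrightarrow> f u \<in> U"
  by (auto simp: line_iff)

lemma line_eq: "line f \<Longrightarrow> u \<in> U \<Longrightarrow> v \<in> U \<Longrightarrow> f u = f v \<longleftrightarrow> u = v"
  by (auto simp: line_iff inj_on_def)

lemma line_image_iff: "line f \<Longrightarrow> Z \<subseteq> U \<Longrightarrow> u \<in> U \<Longrightarrow> f u \<in> f ` Z \<longleftrightarrow> u \<in> Z"
  by (auto simp: line_iff inj_on_def)

lemma line_obtain:
  assumes "line f" "s \<in> U" obtains u where "u \<in> U" "f u = s"
  using assms unfolding line_def bij_betw_def by (metis imageE)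

text \<open>The pointwise form is stable under arbitrary intersections, so that least closed sets exist.\<close>
lemma closed_set_iff:
  assumes "line f" "line g"
  shows "closed_set f g Z \<longleftrightarrow>
    Z \<subseteq> U \<and> (\<forall>u\<in>U. \<forall>v\<in>U. f u = g v \<longrightarrow> (u \<in> Z \<longleftrightarrow> v \<in> Z))"
proof
  assume c: "closed_set f g Z"
  then have Z: "Z \<subseteq> U" and e: "f ` Z = g ` Z" by (auto simp: closed_set_def)
  have "u \<in> Z \<longleftrightarrow> v \<in> Z" if "u \<in> U" "v \<in> U" "f u = g v" for u v
    using line_image_iff[OF assms(1) Z that(1)] line_image_iff[OF assms(2) Z that(2)] that(3) e
    by simp
  then show "Z \<subseteq> U \<and> (\<forall>u\<in>U. \<forall>v\<in>U. f u = g v \<longrightarrow> (u \<in> Z \<longleftrightarrow> v \<in> Z))" using Z by blast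
next
  assume r: "Z \<subseteq> U \<and> (\<forall>u\<in>U. \<forall>v\<in>U. f u = g v \<longrightarrow> (u \<in> Z \<longleftrightarrow> v \<in> Z))"
  have "f ` Z \<subseteq> g ` Z"
  proof
    fix s assume "s \<in> f ` Z"
    then obtain u where u: "u \<in> Z" "s = f u" by auto
    then have "s \<in> U" using r line_mem[OF assms(1)] by auto
    then obtain v where "v \<in> U" "g v = s" using line_obtain[OF assms(2)] by metis
    then show "s \<in> g ` Z" using u r by (metis imageI subsetD)
  qed
  moreover have "g ` Z \<subseteq> f ` Z"
  proof
    fix s assume "s \<in> g ` Z"
    then obtain u where u: "u \<in> Z" "s = g u" by auto
    then have "s \<in> U" using r line_mem[OF assms(2)] by auto
    then obtain v where "v \<in> U" "f v = s" using line_obtain[OF assms(1)] by metis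
    then show "s \<in> f ` Z" using u r by (metis imageI subsetD)
  qed
  ultimately show "closed_set f g Z" using r by (auto simp: closed_set_def)
qed

lemma closed_set_compl:
  assumes "line f" "line g" "closed_set f g Z" shows "closed_set f g (U - Z)"
  using assms by (auto simp: closed_set_iff)

lemma closed_set_U: "line f \<Longrightarrow> line g \<Longrightarrow> closed_set f g U"
  by (simp add: closed_set_iff)

lemma closed_set_sym: "closed_set f g Z \<longleftrightarrow> closed_set g f Z"
  by (auto simp: closed_set_def)

lemma component_closed:
  assumes "line f" "line g" "u \<in> U" shows "closed_set f g (component f g u)"
proof -
  have "component f g u \<subseteq> U" using closed_set_U[OF assms(1,2)] assms(3) by (auto simp: component_def)
  then show ?thesis using assms by (auto simp: closed_set_iff component_def)
qed

lemma component_self: "u \<in> component f g u"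
  by (auto simp: component_def)

lemma component_least: "closed_set f g Z \<Longrightarrow> u \<in> Z \<Longrightarrow> component f g u \<subseteq> Z"
  by (auto simp: component_def)

lemma bridge_iff:
  assumes "line f" "line g" "s \<in> U" "t \<in> U" "s \<noteq> t"
  shows "bridge f g s t K \<longleftrightarrow> K \<subseteq> U \<and> (\<forall>u\<in>U. f u = s \<longrightarrow> u \<notin> K) \<and> (\<forall>u\<in>U. g u = t \<longrightarrow> u \<notin> K) \<and>
      (\<forall>u\<in>U. f u = t \<longrightarrow> u \<in> K) \<and> (\<forall>u\<in>U. g u = s \<longrightarrow> u \<in> K) \<and>
      (\<forall>u\<in>U. \<forall>v\<in>U. f u = g v \<longrightarrow> f u \<noteq> s \<longrightarrow> f u \<noteq> t \<longrightarrow> (u \<in> K \<longleftrightarrow> v \<in> K))" (is "_ \<longleftrightarrow> ?R")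
proof
  assume b: "bridge f g s t K"
  then have K: "K \<subseteq> U" and e: "s \<notin> f ` K" "t \<notin> g ` K" "insert s (f ` K) = insert t (g ` K)"
    by (auto simp: bridge_def)
  note fi = line_image_iff[OF assms(1) K] and gi = line_image_iff[OF assms(2) K]
  show ?R
  proof (intro conjI ballI impI K)
    fix u assume "u \<in> U" "f u = s" then show "u \<notin> K" using fi e by auto
  next
    fix u assume "u \<in> U" "g u = t" then show "u \<notin> K" using gi e by auto
  next
    fix u assume "u \<in> U" "f u = t" then show "u \<in> K" using fi e assms(5) by (metis insert_iff)
  next
    fix u assume "u \<in> U" "g u = s" then show "u \<in> K" using gi e assms(5) by (metis insert_iff)
  next
    fix u v assume "u \<in> U" "v \<in> U" "f u = g v" "f u \<noteq> s" "f u \<noteq> t"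
    then show "u \<in> K \<longleftrightarrow> v \<in> K" using fi gi e by (metis insert_iff)
  qed
next
  assume r: ?R
  then have K: "K \<subseteq> U" by blast
  note fi = line_image_iff[OF assms(1) K] and gi = line_image_iff[OF assms(2) K]
  have mem: "x \<in> insert s (f ` K) \<longleftrightarrow> x \<in> insert t (g ` K)" for x
  proof (cases "x \<in> U")
    case True
    obtain u where u: "u \<in> U" "f u = x" using line_obtain[OF assms(1) True] .
    obtain v where v: "v \<in> U" "g v = x" using line_obtain[OF assms(2) True] .
    show ?thesis using fi[OF u(1)] gi[OF v(1)] r u v by (metis insert_iff)
  next
    case False
    then show ?thesis using assms K line_mem[OF assms(1)] line_mem[OF assms(2)] by auto
  qed
  then show "bridge f g s t K" using r K by (auto simp: bridge_def)
qed

lemma least_bridge: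
  assumes "line f" "line g" "s \<in> U" "t \<in> U" "s \<noteq> t" "bridge f g s t K"
  shows "bridge f g s t (least_bridge f g s t)" "least_bridge f g s t \<subseteq> K"
proof -
  show s: "least_bridge f g s t \<subseteq> K" using assms(6) by (auto simp: least_bridge_def)
  have K: "K \<subseteq> U" using assms(6) by (simp add: bridge_def)
  show "bridge f g s t (least_bridge f g s t)"
    unfolding bridge_iff[OF assms(1-5)]
  proof (intro conjI ballI impI)
    show "least_bridge f g s t \<subseteq> U" using s K by blast
  next
    fix u assume "u \<in> U" "f u = s" then show "u \<notin> least_bridge f g s t"
      using s assms(6) bridge_iff[OF assms(1-5), of K] by blast
  next
    fix u assume "u \<in> U" "g u = t" then show "u \<notin> least_bridge f g s t"
      using s assms(6) bridge_iff[OF assms(1-5), of K] by blast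
  next
    fix u assume "u \<in> U" "f u = t" then show "u \<in> least_bridge f g s t"
      using bridge_iff[OF assms(1-5)] unfolding least_bridge_def by blast
  next
    fix u assume "u \<in> U" "g u = s" then show "u \<in> least_bridge f g s t"
      using bridge_iff[OF assms(1-5)] unfolding least_bridge_def by blast
  next
    fix u v assume a: "u \<in> U" "v \<in> U" "f u = g v" "f u \<noteq> s" "f u \<noteq> t"
    then have "u \<in> K' \<longleftrightarrow> v \<in> K'" if "bridge f g s t K'" for K'
      using bridge_iff[OF assms(1-5), of K'] that by blast
    then show "u \<in> least_bridge f g s t \<longleftrightarrow> v \<in> least_bridge f g s t"
      unfolding least_bridge_def by blast
  qed
qed

text \<open>Following the cycle from the position with \<open>g\<close>-symbol \<open>s\<close>, one either meets the position with \<open>g\<close>-symbol \<open>t\<close> or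
  returns to the start. Instead of following it step by step, a maximal partial path \<open>Z\<close> is taken: the
  images \<open>g ` Z\<close> and \<open>insert s (f ` Z)\<close> then agree up to at most one symbol.\<close>
lemma bridge_or_closed:
  assumes f: "line f" and g: "line g" and st: "s \<in> U" "t \<in> U" "s \<noteq> t"
  shows "(\<exists>K. bridge f g s t K) \<or> (\<exists>Z. closed_set f g Z \<and> t \<in> f ` Z \<and> s \<notin> f ` Z)"
proof -
  \<comment> \<open>sets containing an initial segment of the cycle that starts at the \<open>g\<close>-position of \<open>s\<close> and has not yet reached \<open>t\<close>\<close>
  define F where "F = {Z. Z \<subseteq> U \<and> s \<in> g ` Z \<and> t \<notin> g ` Z \<and> g ` Z \<subseteq> insert s (f ` Z)}"
  have finF: "finite F" using fin by (auto simp: F_def intro: finite_subset[of _ "Pow U"])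
  obtain z0 where z0: "z0 \<in> U" "g z0 = s" using line_obtain[OF g st(1)] .
  have "{z0} \<in> F" using z0 st by (auto simp: F_def)
  then obtain Z where Z: "Z \<in> F" and mx: "\<And>Z'. Z' \<in> F \<Longrightarrow> Z \<subseteq> Z' \<Longrightarrow> Z' = Z"
    using finite_has_maximal[OF finF] by (metis empty_iff)
  have ZU: "Z \<subseteq> U" and sZ: "s \<in> g ` Z" and tZ: "t \<notin> g ` Z" and gZ: "g ` Z \<subseteq> insert s (f ` Z)"
    using Z by (auto simp: F_def)
  have finZ: "finite Z" using ZU fin finite_subset by blast
  have cf: "card (f ` Z) = card Z" using f ZU by (meson card_image inj_on_subset line_iff)
  have cg: "card (g ` Z) = card Z" using g ZU by (meson card_image inj_on_subset line_iff)
  show ?thesis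
  proof (cases "s \<in> f ` Z")
    case True
    then have "g ` Z \<subseteq> f ` Z" using gZ by blast
    then have "f ` Z = g ` Z" using cf cg finZ by (metis card_subset_eq finite_imageI)
    then have c: "closed_set f g Z" using ZU by (simp add: closed_set_def)
    have c': "closed_set f g (U - Z)" using closed_set_compl[OF f g c] .
    obtain z where z: "z \<in> U" "f z = t" using line_obtain[OF f st(2)] .
    have "z \<notin> Z" using tZ c z by (auto simp: closed_set_def)
    then have "t \<in> f ` (U - Z)" using z by blast
    moreover have "s \<notin> f ` (U - Z)"
    proof
      assume "s \<in> f ` (U - Z)"
      then obtain z' where "z' \<in> U" "z' \<notin> Z" "f z' = s" by auto
      then show False using True line_image_iff[OF f ZU] by metis
    qed
    ultimately show ?thesis using c' by blast
  next
    case False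
    then have "card (insert s (f ` Z)) = Suc (card Z)" using cf finZ by simp
    then have "insert s (f ` Z) \<noteq> g ` Z" using cg by auto
    then obtain a where a: "a \<in> insert s (f ` Z)" "a \<notin> g ` Z" using gZ by blast
    have "a \<in> U" using a st ZU line_mem[OF f] by auto
    then obtain z where z: "z \<in> U" "g z = a" using line_obtain[OF g] by metis
    have zZ: "z \<notin> Z" using a z by auto
    have "g ` insert z Z \<subseteq> insert s (f ` Z)" using gZ a z by auto
    have "a = t"
    proof (rule ccontr)
      assume "a \<noteq> t"
      then have "insert z Z \<in> F" using Z z gZ a by (auto simp: F_def)
      then show False using mx[of "insert z Z"] zZ by auto
    qed
    have "insert t (g ` Z) \<subseteq> insert s (f ` Z)" using a \<open>a = t\<close> gZ by auto
    moreover have "card (insert t (g ` Z)) = Suc (card Z)" using tZ cg finZ by simp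
    ultimately have "insert t (g ` Z) = insert s (f ` Z)"
      using \<open>card (insert s (f ` Z)) = Suc (card Z)\<close> finZ by (metis card_subset_eq finite_imageI finite_insert)
    then have "bridge f g s t Z" using ZU False tZ by (auto simp: bridge_def)
    then show ?thesis by blast
  qed
qed

definition swap_on :: "nat set \<Rightarrow> (nat \<Rightarrow> nat) \<Rightarrow> (nat \<Rightarrow> nat) \<Rightarrow> nat \<Rightarrow> nat" where
  "swap_on Z f g = (\<lambda>u. if u \<in> Z then g u else f u)"

lemma swap_on_line:
  assumes f: "line f" and g: "line g" and c: "closed_set f g Z"
  shows "line (swap_on Z f g)"
  unfolding line_iff
proof
  show "swap_on Z f g ` U \<subseteq> U" using line_mem[OF f] line_mem[OF g] by (auto simp: swap_on_def)
  show "inj_on (swap_on Z f g) U"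
    using c unfolding closed_set_iff[OF f g] inj_on_def swap_on_def
    by (auto simp: line_eq[OF f] line_eq[OF g])
qed

lemma swap_on_closed:
  assumes f: "line f" and g: "line g" and c: "closed_set f g Z"
  shows "closed_set (swap_on Z f g) (swap_on Z g f) Y \<longleftrightarrow> closed_set f g Y"
proof -
  have c': "closed_set g f Z" using c closed_set_sym by blast
  note l = swap_on_line[OF f g c] swap_on_line[OF g f c']
  have z: "f u = g v \<Longrightarrow> u \<in> U \<Longrightarrow> v \<in> U \<Longrightarrow> u \<in> Z \<longleftrightarrow> v \<in> Z" for u v
    using c unfolding closed_set_iff[OF f g] by blast
  have e: "swap_on Z f g u = swap_on Z g f v \<longleftrightarrow> (if u \<in> Z then f v = g u else f u = g v)"
    if "u \<in> U" "v \<in> U" for u v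
  proof (cases "u \<in> Z"; cases "v \<in> Z")
  qed (use z[OF _ that] z[OF _ that(2,1)] line_eq[OF f that] line_eq[OF g that] in \<open>auto simp: swap_on_def\<close>)
  have "(\<forall>u\<in>U. \<forall>v\<in>U. swap_on Z f g u = swap_on Z g f v \<longrightarrow> (u \<in> Y \<longleftrightarrow> v \<in> Y)) \<longleftrightarrow>
      (\<forall>u\<in>U. \<forall>v\<in>U. f u = g v \<longrightarrow> (u \<in> Y \<longleftrightarrow> v \<in> Y))" (is "?A \<longleftrightarrow> ?B")
  proof
    assume A: ?A
    show ?B
    proof (intro ballI impI)
      fix u v assume u: "u \<in> U" and v: "v \<in> U" and uv: "f u = g v"
      show "u \<in> Y \<longleftrightarrow> v \<in> Y"
      proof (cases "u \<in> Z")
        case True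
        then have "swap_on Z f g v = swap_on Z g f u" using e[OF v u] z[OF uv u v] uv by simp
        then show ?thesis using A u v by blast
      next
        case False
        then have "swap_on Z f g u = swap_on Z g f v" using e[OF u v] uv by simp
        then show ?thesis using A u v by blast
      qed
    qed
  next
    assume B: ?B
    show ?A
    proof (intro ballI impI)
      fix u v assume u: "u \<in> U" and v: "v \<in> U" and uv: "swap_on Z f g u = swap_on Z g f v"
      then show "u \<in> Y \<longleftrightarrow> v \<in> Y" using e[OF u v] B by (cases "u \<in> Z") auto
    qed
  qed
  then show ?thesis by (simp add: closed_set_iff[OF f g] closed_set_iff[OF l])
qed

text \<open>The line \<open>f\<close> after the exchange along a bridge; the other line is \<open>bridge_line K t s g f\<close>.\<close>
definition bridge_line :: "nat set \<Rightarrow> nat \<Rightarrow> nat \<Rightarrow> (nat \<Rightarrow> nat) \<Rightarrow> (nat \<Rightarrow> nat) \<Rightarrow> nat \<Rightarrow> nat" where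
  "bridge_line K s t f g = (\<lambda>u. if f u = s then t else if u \<in> K then g u else f u)"

lemma bridge_sym: "bridge f g s t K \<longleftrightarrow> bridge g f t s K"
  by (auto simp: bridge_def)

lemma bridge_line_line:
  assumes f: "line f" and g: "line g" and st: "s \<in> U" "t \<in> U" "s \<noteq> t" and b: "bridge f g s t K"
  shows "line (bridge_line K s t f g)"
  unfolding line_iff
proof
  show "bridge_line K s t f g ` U \<subseteq> U" using line_mem[OF f] line_mem[OF g] st by (auto simp: bridge_line_def)
  note b = b[unfolded bridge_iff[OF f g st]]
  show "inj_on (bridge_line K s t f g) U"
  proof (rule inj_onI)
    fix u v assume u: "u \<in> U" and v: "v \<in> U" and e: "bridge_line K s t f g u = bridge_line K s t f g v"
    show "u = v"
    proof (cases "f u = s"; cases "f v = s")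
      assume "f u = s" "f v = s" then show ?thesis using line_eq[OF f u v] by simp
    next
      assume a: "f u = s" "f v \<noteq> s"
      then have "(if v \<in> K then g v else f v) = t" using e by (simp add: bridge_line_def)
      then show ?thesis using b v by (cases "v \<in> K") auto
    next
      assume a: "f u \<noteq> s" "f v = s"
      then have "(if u \<in> K then g u else f u) = t" using e by (simp add: bridge_line_def)
      then show ?thesis using b u by (cases "u \<in> K") auto
    next
      assume a: "f u \<noteq> s" "f v \<noteq> s"
      then have e': "(if u \<in> K then g u else f u) = (if v \<in> K then g v else f v)"
        using e by (simp add: bridge_line_def)
      have k: "\<not> (x \<in> K \<and> y \<notin> K \<and> g x = f y)" if "x \<in> U" "y \<in> U" "f y \<noteq> s" for x y
      proof
        assume a: "x \<in> K \<and> y \<notin> K \<and> g x = f y"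
        then have "f y \<noteq> t" using b that(2) by blast
        moreover have "\<forall>u\<in>U. \<forall>v\<in>U. f u = g v \<longrightarrow> f u \<noteq> s \<longrightarrow> f u \<noteq> t \<longrightarrow> (u \<in> K \<longleftrightarrow> v \<in> K)"
          using b by blast
        ultimately have "y \<in> K \<longleftrightarrow> x \<in> K" using that a by metis
        then show False using a by blast
      qed
      show ?thesis
        using e' k[of u v] k[of v u] a u v line_eq[OF f u v] line_eq[OF g u v] by (auto split: if_splits)
    qed
  qed
qed

lemma image_line_diff:
  assumes "line f" "A \<subseteq> U" "B \<subseteq> U" shows "f ` (A - B) = f ` A - f ` B"
  using assms by (auto simp: line_iff inj_on_def)

lemma bridge_diff_closed:
  assumes f: "line f" and g: "line g" and K: "bridge f g s t K" and K': "bridge f g s t K'" and sub: "K' \<subseteq> K"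
  shows "closed_set f g (K - K')"
proof -
  have KU: "K \<subseteq> U" "K' \<subseteq> U" using K K' by (auto simp: bridge_def)
  have s: "s \<notin> f ` K" "t \<notin> g ` K" using K by (auto simp: bridge_def)
  have "f ` (K - K') = insert s (f ` K) - insert s (f ` K')"
    using s unfolding image_line_diff[OF f KU] by blast
  also have "\<dots> = insert t (g ` K) - insert t (g ` K')" using K K' by (simp add: bridge_def)
  also have "\<dots> = g ` (K - K')"
    using s unfolding image_line_diff[OF g KU] by blast
  finally show ?thesis using KU by (auto simp: closed_set_def)
qed

lemma bridge_minus_closed:
  assumes f: "line f" and g: "line g" and K: "bridge f g s t K" and D: "closed_set f g D" and sub: "D \<subseteq> K"
  shows "bridge f g s t (K - D)"
proof -
  have KU: "K \<subseteq> U" "D \<subseteq> U" using K D by (auto simp: bridge_def closed_set_def)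
  have s: "s \<notin> f ` D" "t \<notin> g ` D" using K sub by (auto simp: bridge_def)
  have "insert s (f ` (K - D)) = insert s (f ` K) - f ` D"
    using s unfolding image_line_diff[OF f KU] by blast
  also have "\<dots> = insert t (g ` K) - g ` D" using K D by (simp add: bridge_def closed_set_def)
  also have "\<dots> = insert t (g ` (K - D))" using s unfolding image_line_diff[OF g KU] by blast
  finally show ?thesis using K KU by (auto simp: bridge_def)
qed

lemma bridge_line_on_bridge:
  assumes "bridge f g s t K" "u \<in> K"
  shows "bridge_line K s t f g u = g u"
  using assms by (auto simp: bridge_line_def bridge_def)

lemma bridge_line_on_bridge':
  assumes "bridge f g s t K" "u \<in> K"
  shows "bridge_line K t s g f u = f u"
  using assms by (auto simp: bridge_line_def bridge_def)

text \<open>The exchange preserves \<open>K\<close> as a bridge, with the symbols interchanged. A smaller bridge \<open>K2\<close> of the new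
  lines would leave \<open>K - K2\<close> closed, for the old lines as well since they are only exchanged there;
  removing it from \<open>K\<close> would give a smaller bridge of the old lines.\<close>
lemma least_bridge_bridge_line:
  assumes f: "line f" and g: "line g" and st: "s \<in> U" "t \<in> U" "s \<noteq> t" and ex: "bridge f g s t K0"
  defines "K \<equiv> least_bridge f g s t"
  shows "bridge (bridge_line K s t f g) (bridge_line K t s g f) t s K"
    "least_bridge (bridge_line K s t f g) (bridge_line K t s g f) t s = K"
proof -
  define f' where "f' = bridge_line K s t f g"
  define g' where "g' = bridge_line K t s g f"
  have K: "bridge f g s t K" and least: "\<And>Y. bridge f g s t Y \<Longrightarrow> K \<subseteq> Y"
    using least_bridge[OF f g st] ex unfolding K_def by blast+
  have f': "line f'" unfolding f'_def by (rule bridge_line_line[OF f g st K])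
  have g': "line g'" unfolding g'_def
    by (rule bridge_line_line[OF g f st(2,1) st(3)[symmetric]]) (use K bridge_sym in blast)
  have f'D: "f' ` D = g ` D" and g'D: "g' ` D = f ` D" if "D \<subseteq> K" for D
    using that bridge_line_on_bridge[OF K] bridge_line_on_bridge'[OF K] unfolding f'_def g'_def
    by (auto intro!: image_cong)
  have b: "bridge f' g' t s K"
    unfolding bridge_def f'D[OF subset_refl] g'D[OF subset_refl] using K by (auto simp: bridge_def)
  define K2 where "K2 = least_bridge f' g' t s"
  have K2: "bridge f' g' t s K2" "K2 \<subseteq> K"
    using least_bridge[OF f' g' st(2,1) st(3)[symmetric] b] unfolding K2_def by blast+
  have "closed_set f' g' (K - K2)" using bridge_diff_closed[OF f' g' b K2] .
  then have "closed_set f g (K - K2)"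
    using f'D[of "K - K2"] g'D[of "K - K2"] by (auto simp: closed_set_def)
  then have "bridge f g s t (K - (K - K2))" using bridge_minus_closed[OF f g K] by blast
  moreover have "K - (K - K2) = K2" using K2(2) by blast
  ultimately have "K \<subseteq> K2" using least by metis
  then show "bridge (bridge_line K s t f g) (bridge_line K t s g f) t s K"
    "least_bridge (bridge_line K s t f g) (bridge_line K t s g f) t s = K"
    using b K2(2) unfolding K2_def f'_def g'_def by auto
qed

text \<open>Two points of a cycle bound two arcs. If \<open>K\<close> is an arc starting at \<open>b'\<close> and ending before \<open>y\<close>, then its complement, with
  the ends adjusted, is an arc starting at \<open>b'\<close> in the opposite direction, so a third point lies on only
  one of them.\<close>
lemma bridge_complement:
  assumes f: "line f" and g: "line g" and b: "b' \<in> U" and y: "y \<in> U" "y \<noteq> b'" and fg: "f b' \<noteq> g b'"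
    and K: "bridge f g (g b') (g y) K"
  shows "bridge g f (f b') (f y) (insert b' (U - K - {y}))"
proof -
  have KU: "K \<subseteq> U" using K by (simp add: bridge_def)
  have im: "f ` U = U" "g ` U = U" using f g by (auto simp: line_def bij_betw_def)
  have yK: "y \<notin> K" using K by (auto simp: bridge_def)
  have bK: "b' \<in> K"
  proof -
    have "g b' \<noteq> g y" using line_eq[OF g b y(1)] y(2) by auto
    then have "g b' \<in> g ` K" using K by (auto simp: bridge_def)
    then show ?thesis using line_image_iff[OF g KU b] by simp
  qed
  define M where "M = insert (g b') (f ` K)"
  have M: "M = insert (g y) (g ` K)" "g b' \<notin> f ` K" using K by (auto simp: bridge_def M_def)
  have s: "g b' \<in> U" "f b' \<in> M" "f y \<notin> f ` K"
    using line_mem[OF g b] bK line_image_iff[OF f KU y(1)] yK by (auto simp: M_def)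
  have e1: "g ` (U - K - {y}) = U - M"
  proof -
    have "U - K - {y} = U - (insert y K)" by blast
    then have "g ` (U - K - {y}) = g ` U - g ` insert y K"
      using image_line_diff[OF g subset_refl, of "insert y K"] KU y by simp
    then show ?thesis using im M by simp
  qed
  have e2: "f ` (U - K - {y}) = U - (insert (f y) (M - {g b'}))"
  proof -
    have "U - K - {y} = U - (insert y K)" by blast
    then have "f ` (U - K - {y}) = f ` U - f ` insert y K"
      using image_line_diff[OF f subset_refl, of "insert y K"] KU y by simp
    moreover have "f ` K = M - {g b'}" using M(2) unfolding M_def by blast
    ultimately show ?thesis using im by simp
  qed
  have fy: "f y \<in> insert (g b') (U - M)" using s(3) line_mem[OF f y(1)] by (auto simp: M_def)
  show ?thesis
    unfolding bridge_def
  proof (intro conjI)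
    show sub: "insert b' (U - K - {y}) \<subseteq> U" using b by blast
    show "f b' \<notin> g ` insert b' (U - K - {y})" using e1 s fg by auto
    have "y \<notin> insert b' (U - K - {y})" using y by blast
    then show "f y \<notin> f ` insert b' (U - K - {y})" using line_image_iff[OF f sub y(1)] by simp
    have "insert (f b') (insert (g b') (U - M)) = insert (f y) (insert (f b') (U - insert (f y) (M - {g b'})))"
      using fy s(1) by blast
    then show "insert (f b') (g ` insert b' (U - K - {y})) = insert (f y) (f ` insert b' (U - K - {y}))"
      by (simp only: image_insert e1 e2)
  qed
qed

end

section \<open>Latin squares and the three moves\<close>

context index_set
begin

text \<open>Outside \<open>U\<close> the matrix is 0, so that there are finitely many Latin squares and they are
  determined by their entries.\<close>
definition latin :: "(nat \<Rightarrow> nat \<Rightarrow> nat) \<Rightarrow> bool" where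
  "latin L \<longleftrightarrow> (\<forall>i\<in>U. line (L i)) \<and> (\<forall>j\<in>U. line (\<lambda>i. L i j)) \<and> (\<forall>i j. i \<notin> U \<or> j \<notin> U \<longrightarrow> L i j = 0)"

definition transposed :: "(nat \<Rightarrow> nat \<Rightarrow> nat) \<Rightarrow> nat \<Rightarrow> nat \<Rightarrow> nat" where
  "transposed L = (\<lambda>i j. L j i)"

lemma latin_transposed [simp]: "latin (transposed L) \<longleftrightarrow> latin L"
  by (auto simp: latin_def transposed_def)

lemma transposed_transposed [simp]: "transposed (transposed L) = L"
  by (simp add: transposed_def)

lemma latin_row: "latin L \<Longrightarrow> i \<in> U \<Longrightarrow> line (L i)"
  by (simp add: latin_def)

lemma latin_col: "latin L \<Longrightarrow> j \<in> U \<Longrightarrow> line (\<lambda>i. L i j)"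
  by (simp add: latin_def)

lemma latin_mem: "latin L \<Longrightarrow> i \<in> U \<Longrightarrow> j \<in> U \<Longrightarrow> L i j \<in> U"
  by (simp add: latin_row line_mem)

lemma latin_row_eq: "latin L \<Longrightarrow> i \<in> U \<Longrightarrow> j \<in> U \<Longrightarrow> k \<in> U \<Longrightarrow> L i j = L i k \<longleftrightarrow> j = k"
  using latin_row line_eq by blast

lemma latin_col_eq: "latin L \<Longrightarrow> j \<in> U \<Longrightarrow> i \<in> U \<Longrightarrow> k \<in> U \<Longrightarrow> L i j = L k j \<longleftrightarrow> i = k"
  using latin_col[of L j] line_eq[of "\<lambda>i. L i j" i k] by simp

definition row_with :: "(nat \<Rightarrow> nat \<Rightarrow> nat) \<Rightarrow> nat \<Rightarrow> nat \<Rightarrow> nat" where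
  "row_with L j s = (THE i. i \<in> U \<and> L i j = s)"

definition col_with :: "(nat \<Rightarrow> nat \<Rightarrow> nat) \<Rightarrow> nat \<Rightarrow> nat \<Rightarrow> nat" where
  "col_with L i s = (THE j. j \<in> U \<and> L i j = s)"

lemma row_with_eqI: "latin L \<Longrightarrow> j \<in> U \<Longrightarrow> i \<in> U \<Longrightarrow> L i j = s \<Longrightarrow> row_with L j s = i"
  unfolding row_with_def using latin_col_eq by (intro the_equality) auto

lemma col_with_eqI: "latin L \<Longrightarrow> i \<in> U \<Longrightarrow> j \<in> U \<Longrightarrow> L i j = s \<Longrightarrow> col_with L i s = j"
  unfolding col_with_def using latin_row_eq by (intro the_equality) auto

lemma row_with:
  assumes "latin L" "j \<in> U" "s \<in> U"
  shows "row_with L j s \<in> U" "L (row_with L j s) j = s"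
proof -
  obtain i where "i \<in> U" "L i j = s" using line_obtain[OF latin_col[OF assms(1,2)] assms(3)] .
  then show "row_with L j s \<in> U" "L (row_with L j s) j = s" using row_with_eqI[OF assms(1,2)] by auto
qed

lemma col_with:
  assumes "latin L" "i \<in> U" "s \<in> U"
  shows "col_with L i s \<in> U" "L i (col_with L i s) = s"
proof -
  obtain j where "j \<in> U" "L i j = s" using line_obtain[OF latin_row[OF assms(1,2)] assms(3)] .
  then show "col_with L i s \<in> U" "L i (col_with L i s) = s" using col_with_eqI[OF assms(1,2)] by auto
qed

lemma finite_latin: "finite {L. latin L}"
proof -
  have "finite {L. (\<forall>i. (i \<in> U \<longrightarrow> L i \<in> {f. \<forall>j. (j \<in> U \<longrightarrow> f j \<in> U) \<and> (j \<notin> U \<longrightarrow> f j = 0)}) \<and> (i \<notin> U \<longrightarrow> L i = (\<lambda>_. 0)))}"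
    by (intro finite_set_of_finite_funs fin)
  then show ?thesis
  proof (rule rev_finite_subset, intro subsetI CollectI allI conjI impI)
    fix L i assume "L \<in> {L. latin L}"
    then have L: "latin L" by simp
    show "j \<in> U \<Longrightarrow> L i j \<in> U" if "i \<in> U" for j using latin_mem[OF L that] .
    show "j \<notin> U \<Longrightarrow> L i j = 0" for j using L by (simp add: latin_def)
    show "i \<notin> U \<Longrightarrow> L i = (\<lambda>_. 0)" using L by (simp add: latin_def fun_eq_iff)
  qed
qed

lemma line_cong: "(\<And>u. u \<in> U \<Longrightarrow> f u = g u) \<Longrightarrow> line f \<longleftrightarrow> line g"
  unfolding line_def by (rule bij_betw_cong)

lemma line_twist:
  assumes f: "line f" and x: "x \<in> U" and y: "y \<in> U"
  shows "line (\<lambda>i. if i = x then f y else if i = y then f x else f i)"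
  unfolding line_iff inj_on_def using line_mem[OF f] line_eq[OF f] x y by auto

definition row_swap :: "nat \<Rightarrow> nat \<Rightarrow> nat set \<Rightarrow> (nat \<Rightarrow> nat \<Rightarrow> nat) \<Rightarrow> nat \<Rightarrow> nat \<Rightarrow> nat" where
  "row_swap x y Z L = (\<lambda>i j. if j \<in> Z then (if i = x then L y j else if i = y then L x j else L i j) else L i j)"

lemma row_swap_latin:
  assumes L: "latin L" and x: "x \<in> U" and y: "y \<in> U" and c: "closed_set (L x) (L y) Z"
  shows "latin (row_swap x y Z L)"
proof -
  have ZU: "Z \<subseteq> U" using c by (simp add: closed_set_def)
  have "line (row_swap x y Z L i)" if i: "i \<in> U" for i
  proof -
    have "row_swap x y Z L i = (if i = x then swap_on Z (L x) (L y) else if i = y then swap_on Z (L y) (L x) else L i)"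
      by (auto simp: row_swap_def swap_on_def)
    then show ?thesis
      using swap_on_line[OF latin_row[OF L x] latin_row[OF L y] c] latin_row[OF L i]
        swap_on_line[OF latin_row[OF L y] latin_row[OF L x]] c closed_set_sym by auto
  qed
  moreover have "line (\<lambda>i. row_swap x y Z L i j)" if j: "j \<in> U" for j
    using line_twist[OF latin_col[OF L j] x y] latin_col[OF L j] by (cases "j \<in> Z") (auto simp: row_swap_def)
  moreover have "row_swap x y Z L i j = 0" if "i \<notin> U \<or> j \<notin> U" for i j
    using that L x y ZU by (auto simp: row_swap_def latin_def)
  ultimately show ?thesis by (auto simp: latin_def)
qed

text \<open>The first move exchanges two rows on the cycle through column \<open>k\<close>; the second, \<open>col_move\<close>, is its transpose.\<close>
definition row_move :: "nat \<Rightarrow> nat \<Rightarrow> nat \<Rightarrow> (nat \<Rightarrow> nat \<Rightarrow> nat) \<Rightarrow> nat \<Rightarrow> nat \<Rightarrow> nat" where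
  "row_move x y k L = row_swap x y (component (L x) (L y) k) L"

lemma row_swap_rows:
  "x \<noteq> y \<Longrightarrow> row_swap x y Z L x = swap_on Z (L x) (L y)"
  "x \<noteq> y \<Longrightarrow> row_swap x y Z L y = swap_on Z (L y) (L x)"
  "i \<noteq> x \<Longrightarrow> i \<noteq> y \<Longrightarrow> row_swap x y Z L i = L i"
  by (auto simp: row_swap_def swap_on_def)

lemma row_swap_row_swap: "x \<noteq> y \<Longrightarrow> row_swap x y Z (row_swap x y Z L) = L"
  by (intro ext) (simp add: row_swap_def)

lemma row_swap_closed:
  assumes L: "latin L" and x: "x \<in> U" and y: "y \<in> U" "x \<noteq> y" and c: "closed_set (L x) (L y) Z"
  shows "closed_set (row_swap x y Z L x) (row_swap x y Z L y) Y \<longleftrightarrow> closed_set (L x) (L y) Y"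
  using swap_on_closed[OF latin_row[OF L x] latin_row[OF L y(1)] c] y by (simp add: row_swap_rows)

lemma row_move:
  assumes L: "latin L" and x: "x \<in> U" and y: "y \<in> U" "x \<noteq> y" and k: "k \<in> U"
  shows "latin (row_move x y k L)"
    "closed_set (row_move x y k L x) (row_move x y k L y) Y \<longleftrightarrow> closed_set (L x) (L y) Y"
    "row_move x y k (row_move x y k L) = L"
proof -
  note c = component_closed[OF latin_row[OF L x] latin_row[OF L y(1)] k]
  show "latin (row_move x y k L)" unfolding row_move_def by (rule row_swap_latin[OF L x y(1) c])
  show cl: "closed_set (row_move x y k L x) (row_move x y k L y) Y \<longleftrightarrow> closed_set (L x) (L y) Y" for Y
    unfolding row_move_def by (rule row_swap_closed[OF L x y c])
  have "component (row_move x y k L x) (row_move x y k L y) k = component (L x) (L y) k"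
    unfolding component_def cl ..
  then show "row_move x y k (row_move x y k L) = L"
    unfolding row_move_def[of x y k "row_move x y k L"]
    by (simp add: row_move_def row_swap_row_swap[OF y(2)])
qed

definition col_move :: "nat \<Rightarrow> nat \<Rightarrow> nat \<Rightarrow> (nat \<Rightarrow> nat \<Rightarrow> nat) \<Rightarrow> nat \<Rightarrow> nat \<Rightarrow> nat" where
  "col_move c d k L = transposed (row_move c d k (transposed L))"

abbreviation col :: "(nat \<Rightarrow> nat \<Rightarrow> nat) \<Rightarrow> nat \<Rightarrow> nat \<Rightarrow> nat" where
  "col L j \<equiv> (\<lambda>i. L i j)"

lemma col_move:
  assumes L: "latin L" and x: "c \<in> U" and y: "d \<in> U" "c \<noteq> d" and k: "k \<in> U"
  shows "latin (col_move c d k L)"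
    "closed_set (col (col_move c d k L) c) (col (col_move c d k L) d) Y \<longleftrightarrow> closed_set (col L c) (col L d) Y"
    "col_move c d k (col_move c d k L) = L"
proof -
  have LT: "latin (transposed L)" using L by simp
  note rm = row_move[OF LT x y k]
  have e: "col (col_move c d k L) = row_move c d k (transposed L)" "transposed L = col L"
    by (simp_all add: col_move_def transposed_def)
  show "latin (col_move c d k L)" using rm(1) by (simp add: col_move_def)
  show "closed_set (col (col_move c d k L) c) (col (col_move c d k L) d) Y \<longleftrightarrow> closed_set (col L c) (col L d) Y"
    using rm(2)[of Y] fun_cong[OF e(1), of c] fun_cong[OF e(1), of d] fun_cong[OF e(2), of c] fun_cong[OF e(2), of d]
    by simp
  show "col_move c d k (col_move c d k L) = L" using rm(3) by (simp add: col_move_def)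
qed

lemma col_move_def': "col_move c d k L = (\<lambda>i j. if i \<in> component (col L c) (col L d) k
     then (if j = c then L i d else if j = d then L i c else L i j) else L i j)"
  by (auto simp: col_move_def row_move_def row_swap_def transposed_def fun_eq_iff)

lemma row_move_def': "row_move x y k L = (\<lambda>i j. if j \<in> component (L x) (L y) k
     then (if i = x then L y j else if i = y then L x j else L i j) else L i j)"
  by (auto simp: row_move_def row_swap_def)

text \<open>The third move. At the corners \<open>(x, c)\<close> and \<open>(y, d)\<close> of a \<open>2 \<times> 2\<close> block the two symbols trade places. Rows \<open>x\<close> and
  \<open>y\<close> are repaired along a bridge \<open>K\<close> of columns, columns \<open>c\<close> and \<open>d\<close> along a bridge \<open>H\<close> of rows. The
  two repairs do not meet, since \<open>c, d \<notin> K\<close> and \<open>x, y \<notin> H\<close>, and the move is its own transpose.\<close>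
definition corner_swap :: "nat set \<Rightarrow> nat set \<Rightarrow> nat \<Rightarrow> nat \<Rightarrow> nat \<Rightarrow> nat \<Rightarrow> (nat \<Rightarrow> nat \<Rightarrow> nat) \<Rightarrow> nat \<Rightarrow> nat \<Rightarrow> nat" where
  "corner_swap K H x y c d L = (\<lambda>i j.
     if i = x \<and> j = c then L y d else if i = y \<and> j = d then L x c
     else if i = x \<and> j \<in> K then L y j else if i = y \<and> j \<in> K then L x j
     else if i \<in> H \<and> j = c then L i d else if i \<in> H \<and> j = d then L i c
     else L i j)"

definition corner_move :: "nat \<Rightarrow> nat \<Rightarrow> nat \<Rightarrow> nat \<Rightarrow> (nat \<Rightarrow> nat \<Rightarrow> nat) \<Rightarrow> nat \<Rightarrow> nat \<Rightarrow> nat" where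
  "corner_move x y c d L = corner_swap (least_bridge (L x) (L y) (L x c) (L y d))
     (least_bridge (col L c) (col L d) (L x c) (L y d)) x y c d L"

definition cornered :: "nat \<Rightarrow> nat \<Rightarrow> nat \<Rightarrow> nat \<Rightarrow> (nat \<Rightarrow> nat \<Rightarrow> nat) \<Rightarrow> bool" where
  "cornered x y c d L \<longleftrightarrow> latin L \<and> x \<in> U \<and> y \<in> U \<and> c \<in> U \<and> d \<in> U \<and> x \<noteq> y \<and> c \<noteq> d \<and> L x c \<noteq> L y d \<and>
     (\<exists>K. bridge (L x) (L y) (L x c) (L y d) K) \<and> (\<exists>H. bridge (col L c) (col L d) (L x c) (L y d) H)"

lemma corner_swap_transposed:
  "c \<notin> K \<Longrightarrow> d \<notin> K \<Longrightarrow> x \<notin> H \<Longrightarrow> y \<notin> H \<Longrightarrow> x \<noteq> y \<Longrightarrow> c \<noteq> d \<Longrightarrow>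
   transposed (corner_swap K H x y c d L) = corner_swap H K c d x y (transposed L)"
  by (intro ext, rename_tac i j, case_tac "j = x"; case_tac "j = y"; case_tac "i = c"; case_tac "i = d")
    (simp_all add: corner_swap_def transposed_def)

lemma corner_swap_rows:
  assumes L: "latin L" and xy: "x \<in> U" "y \<in> U" "x \<noteq> y" and cd: "c \<in> U" "d \<in> U" "c \<noteq> d"
    and K: "c \<notin> K" "d \<notin> K" and H: "x \<notin> H" "y \<notin> H" and j: "j \<in> U"
  shows "corner_swap K H x y c d L x j = bridge_line K (L x c) (L y d) (L x) (L y) j"
    "corner_swap K H x y c d L y j = bridge_line K (L y d) (L x c) (L y) (L x) j"
  using K H xy(3) cd(3) j latin_row_eq[OF L xy(1) j cd(1)] latin_row_eq[OF L xy(2) j cd(2)]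
  by (simp_all add: corner_swap_def bridge_line_def)

lemma corner_swap_row_line:
  assumes L: "latin L" and xy: "x \<in> U" "y \<in> U" "x \<noteq> y" and cd: "c \<in> U" "d \<in> U" "c \<noteq> d"
    and ne: "L x c \<noteq> L y d"
    and K: "bridge (L x) (L y) (L x c) (L y d) K" "c \<notin> K" "d \<notin> K" and H: "x \<notin> H" "y \<notin> H" and i: "i \<in> U"
  shows "line (corner_swap K H x y c d L i)"
proof -
  note r = corner_swap_rows[OF L xy cd K(2,3) H]
  note b = latin_row[OF L xy(1)] latin_row[OF L xy(2)] latin_mem[OF L xy(1) cd(1)] latin_mem[OF L xy(2) cd(2)]
  consider "i = x" | "i = y" | "i \<noteq> x" "i \<noteq> y" by blast
  then show ?thesis
  proof cases
    case 1
    then show ?thesis using bridge_line_line[OF b ne K(1)] line_cong[OF r(1)] by simp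
  next
    case 2
    then show ?thesis using bridge_line_line[OF b(2,1,4,3) ne[symmetric]] K(1) bridge_sym line_cong[OF r(2)] by simp
  next
    case 3
    then have "corner_swap K H x y c d L i = (if i \<in> H then (\<lambda>j. if j = c then L i d else if j = d then L i c else L i j) else L i)"
      by (auto simp: corner_swap_def)
    then show ?thesis using line_twist[OF latin_row[OF L i] cd(1,2)] latin_row[OF L i] by auto
  qed
qed

text \<open>The move is an involution: the result has the same least bridges, with the two corner symbols
  interchanged.\<close>
lemma corner_move:
  assumes "cornered x y c d L"
  defines "K \<equiv> least_bridge (L x) (L y) (L x c) (L y d)"
    and "H \<equiv> least_bridge (col L c) (col L d) (L x c) (L y d)"
  shows "bridge (L x) (L y) (L x c) (L y d) K" "bridge (col L c) (col L d) (L x c) (L y d) H"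
    "c \<notin> K" "d \<notin> K" "x \<notin> H" "y \<notin> H" "K \<subseteq> U" "H \<subseteq> U"
    "latin (corner_move x y c d L)" "corner_move x y c d (corner_move x y c d L) = L"
proof -
  have L: "latin L" and xy: "x \<in> U" "y \<in> U" "x \<noteq> y" and cd: "c \<in> U" "d \<in> U" "c \<noteq> d" and ne: "L x c \<noteq> L y d"
    using assms(1) by (auto simp: cornered_def)
  note r = latin_row[OF L xy(1)] latin_row[OF L xy(2)]
  note cl = latin_col[OF L cd(1)] latin_col[OF L cd(2)]
  note st = latin_mem[OF L xy(1) cd(1)] latin_mem[OF L xy(2) cd(2)] ne
  obtain K' H' where K': "bridge (L x) (L y) (L x c) (L y d) K'" and H': "bridge (col L c) (col L d) (L x c) (L y d) H'"
    using assms(1) by (auto simp: cornered_def)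
  show K: "bridge (L x) (L y) (L x c) (L y d) K" using least_bridge[OF r st K'] unfolding K_def by blast
  show H: "bridge (col L c) (col L d) (L x c) (L y d) H" using least_bridge[OF cl st H'] unfolding H_def by blast
  show o: "c \<notin> K" "d \<notin> K" "x \<notin> H" "y \<notin> H" "K \<subseteq> U" "H \<subseteq> U" using K H by (auto simp: bridge_def)
  define M where "M = corner_move x y c d L"
  have M: "M = corner_swap K H x y c d L" by (simp add: M_def corner_move_def K_def H_def)
  have MT: "transposed M = corner_swap H K c d x y (transposed L)"
    unfolding M by (rule corner_swap_transposed) (use o xy cd in auto)
  have LT: "latin (transposed L)" using L by simp
  have neT: "transposed L c x \<noteq> transposed L d y" using ne by (simp add: transposed_def)
  have HT: "bridge (transposed L c) (transposed L d) (transposed L c x) (transposed L d y) H"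
    using H by (simp add: transposed_def)
  have "line (M i)" if "i \<in> U" for i
    unfolding M by (rule corner_swap_row_line[OF L xy cd ne K o(1-4) that])
  moreover have "line (\<lambda>i. M i j)" if "j \<in> U" for j
    using corner_swap_row_line[OF LT cd xy neT HT o(3,4,1,2) that] unfolding MT[symmetric] by (simp add: transposed_def)
  moreover have "M i j = 0" if "i \<notin> U \<or> j \<notin> U" for i j
  proof -
    have "\<not> (i = x \<and> j = c)" "\<not> (i = y \<and> j = d)" "\<not> (i = x \<and> j \<in> K)" "\<not> (i = y \<and> j \<in> K)"
      "\<not> (i \<in> H \<and> j = c)" "\<not> (i \<in> H \<and> j = d)" "L i j = 0"
      using that xy cd o(5,6) L by (auto simp: latin_def)
    then show ?thesis by (simp only: M corner_swap_def if_False)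
  qed
  ultimately show Ml: "latin (corner_move x y c d L)" unfolding M_def[symmetric] by (auto simp: latin_def)
  have Mx: "M x j = bridge_line K (L x c) (L y d) (L x) (L y) j"
    and My: "M y j = bridge_line K (L y d) (L x c) (L y) (L x) j" if "j \<in> U" for j
    using corner_swap_rows[OF L xy cd o(1-4) that] unfolding M by auto
  have Mc: "M i c = bridge_line H (L x c) (L y d) (col L c) (col L d) i"
    and Md: "M i d = bridge_line H (L y d) (L x c) (col L d) (col L c) i" if "i \<in> U" for i
    using corner_swap_rows[OF LT cd xy o(3,4,1,2) that] unfolding MT[symmetric] by (auto simp: transposed_def)
  have cor: "M x c = L y d" "M y d = L x c" using xy cd by (auto simp: M corner_swap_def)
  have lb: "least_bridge (M x) (M y) (M x c) (M y d) = K"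
  proof -
    have "bridge (M x) (M y) (M x c) (M y d) Y \<longleftrightarrow>
        bridge (bridge_line K (L x c) (L y d) (L x) (L y)) (bridge_line K (L y d) (L x c) (L y) (L x)) (L y d) (L x c) Y" for Y
    proof (cases "Y \<subseteq> U")
      case True
      then have "M x ` Y = bridge_line K (L x c) (L y d) (L x) (L y) ` Y"
        "M y ` Y = bridge_line K (L y d) (L x c) (L y) (L x) ` Y" using Mx My by (auto intro!: image_cong)
      then show ?thesis by (simp add: bridge_def cor)
    qed (simp add: bridge_def)
    then show ?thesis
      using least_bridge_bridge_line(2)[OF r st K'] unfolding K_def[symmetric] by (simp add: least_bridge_def)
  qed
  have lbH: "least_bridge (col M c) (col M d) (M x c) (M y d) = H"
  proof -
    have "bridge (col M c) (col M d) (M x c) (M y d) Y \<longleftrightarrow>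
        bridge (bridge_line H (L x c) (L y d) (col L c) (col L d)) (bridge_line H (L y d) (L x c) (col L d) (col L c)) (L y d) (L x c) Y" for Y
    proof (cases "Y \<subseteq> U")
      case True
      then have "col M c ` Y = bridge_line H (L x c) (L y d) (col L c) (col L d) ` Y"
        "col M d ` Y = bridge_line H (L y d) (L x c) (col L d) (col L c) ` Y" using Mc Md by (auto intro!: image_cong)
      then show ?thesis by (simp add: bridge_def cor)
    qed (simp add: bridge_def)
    then show ?thesis
      using least_bridge_bridge_line(2)[OF cl st H'] unfolding H_def[symmetric] by (simp add: least_bridge_def)
  qed
  have "corner_move x y c d M = corner_swap K H x y c d M"
    unfolding corner_move_def lb lbH ..
  also have "\<dots> = L"
  proof (intro ext)
    fix i j
    show "corner_swap K H x y c d M i j = L i j"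
      by (cases "i = x"; cases "i = y"; cases "j = c"; cases "j = d")
        (use o xy cd in \<open>simp_all add: corner_swap_def M\<close>)
  qed
  finally show "corner_move x y c d (corner_move x y c d L) = L" unfolding M_def .
qed

end

section \<open>Intercalates through a constrained cell are rare\<close>

context index_set begin

lemma row_move_other: "i \<noteq> x \<Longrightarrow> i \<noteq> y \<Longrightarrow> row_move x y k L i = L i"
  by (simp add: row_move_def row_swap_rows)

lemma row_move_outside: "j \<notin> component (L x) (L y) k \<Longrightarrow> row_move x y k L i j = L i j"
  by (simp add: row_move_def')

lemma row_move_inside:
  assumes "j \<in> component (L x) (L y) k"
  shows "row_move x y k L x j = L y j" "row_move x y k L y j = L x j"
  using assms by (auto simp: row_move_def')

lemma col_move_other: "j \<noteq> c \<Longrightarrow> j \<noteq> d \<Longrightarrow> col_move c d k L i j = L i j"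
  by (simp add: col_move_def')

lemma col_move_outside: "i \<notin> component (col L c) (col L d) k \<Longrightarrow> col_move c d k L i = L i"
  by (simp add: col_move_def' fun_eq_iff)

lemma col_move_inside:
  assumes "i \<in> component (col L c) (col L d) k" "c \<noteq> d"
  shows "col_move c d k L i c = L i d" "col_move c d k L i d = L i c"
  using assms by (auto simp: col_move_def')

lemma separating_or_bridge:
  assumes L: "latin L" and x: "x \<in> U" and y: "y \<in> U" and c: "c \<in> U" and d: "d \<in> U" and ne: "L x c \<noteq> L y d"
    and no: "\<nexists>Z. closed_set (L x) (L y) Z \<and> d \<in> Z \<and> c \<notin> Z"
  shows "\<exists>K. bridge (L x) (L y) (L x c) (L y d) K"
proof (rule ccontr)
  assume "\<nexists>K. bridge (L x) (L y) (L x c) (L y d) K"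
  then obtain Z where Z: "closed_set (L x) (L y) Z" "L y d \<in> L x ` Z" "L x c \<notin> L x ` Z"
    using bridge_or_closed[OF latin_row[OF L x] latin_row[OF L y] latin_mem[OF L x c] latin_mem[OF L y d] ne] by blast
  have ZU: "Z \<subseteq> U" using Z(1) by (simp add: closed_set_def)
  have "L y d \<in> L y ` Z" using Z(1,2) by (simp add: closed_set_def)
  then have "d \<in> Z" using line_image_iff[OF latin_row[OF L y] ZU d] by simp
  moreover have "c \<notin> Z" using Z(3) by blast
  ultimately show False using no Z(1) by blast
qed

end

text \<open>The setting of the count of intercalates: \<open>T\<close> is a set of Latin squares that are constrained only in the
  block \<open>R \<times> C\<close> and in the two cells \<open>(r, e)\<close> and \<open>(b, c)\<close>, and the cells \<open>(r, c)\<close>, \<open>(r, e)\<close>, \<open>(b, c)\<close> are three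
  cells of an intercalate on rows \<open>r\<close>, \<open>b\<close> and columns \<open>c\<close>, \<open>e\<close>. Row \<open>b\<close> and column \<open>e\<close> lie outside the block.\<close>
locale pinned_family = index_set +
  fixes R C :: "nat set" and r c b e w u :: nat and T :: "(nat \<Rightarrow> nat \<Rightarrow> nat) set"
  assumes RU: "R \<subseteq> U" and CU: "C \<subseteq> U" and rR: "r \<in> R" and cC: "c \<in> C"
    and bU: "b \<in> U" and bR: "b \<notin> R" and eU: "e \<in> U" and eC: "e \<notin> C"
    and T_latin: "L \<in> T \<Longrightarrow> latin L"
    and T_pins: "L \<in> T \<Longrightarrow> L r c = w \<and> L r e = u \<and> L b c = u"
    and T_closed: "L \<in> T \<Longrightarrow> latin M \<Longrightarrow> (\<And>i j. i \<in> R \<Longrightarrow> j \<in> C \<Longrightarrow> M i j = L i j) \<Longrightarrow>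
      M r e = L r e \<Longrightarrow> M b c = L b c \<Longrightarrow> M \<in> T"
begin

definition "free_rows = U - R"
definition "intercalates = {L \<in> T. L b e = w}"
definition "moved k = {L \<in> T. L b k = w}"
text \<open>Columns \<open>e\<close> and \<open>k\<close> split the rows into cycles, and here \<open>b\<close> and \<open>r\<close> lie on different ones.\<close>
definition "separated k = {L \<in> intercalates. \<exists>Z. closed_set (col L e) (col L k) Z \<and> b \<in> Z \<and> r \<notin> Z}"
text \<open>For \<open>{p, q} = {e, k}\<close>, these are the places where the cycle of \<open>b\<close> can be cut: \<open>row_with L p (L b q)\<close> is the neighbour of
  \<open>b\<close> in one direction, the bridge is the arc from \<open>b\<close> to \<open>y\<close> in the other direction, and \<open>r\<close> is not on
  it. The two orders of \<open>e\<close> and \<open>k\<close> are the two directions on the cycle.\<close>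
definition "cuts p q = {(L, y). L \<in> intercalates \<and> y \<in> free_rows - {b} \<and> row_with L p (L b q) \<in> free_rows - {y} \<and>
    (\<exists>K. bridge (col L p) (col L q) (L b q) (L y q) K \<and> r \<notin> K)}"
text \<open>Here \<open>r\<close> is on the cycle of \<open>b\<close>, and both neighbours of \<open>b\<close> on it are rows that may be rearranged.\<close>
definition "linked k = {L \<in> intercalates - separated k. row_with L e (L b k) \<in> free_rows \<and> row_with L k w \<in> free_rows}"
text \<open>The row \<open>y\<close> is on another cycle, which can be joined to that of \<open>b\<close>.\<close>
definition "joins k = {(L, y). L \<in> linked k \<and> y \<in> free_rows - {b, row_with L e (L b k)} \<and>
    (\<exists>Z. closed_set (col L e) (col L k) Z \<and> b \<in> Z \<and> y \<notin> Z)}"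

lemma elems: "r \<in> U" "c \<in> U" "r \<noteq> b" "c \<noteq> e" using RU CU rR cC bR eC by auto

lemma finite_T: "finite T"
  by (rule finite_subset[OF _ finite_latin]) (auto dest: T_latin)

lemma finite_sets: "finite intercalates" "finite (moved k)" "finite (separated k)" "finite (linked k)" "finite free_rows"
  using finite_T fin by (auto simp: intercalates_def moved_def separated_def linked_def free_rows_def)

lemma finite_cuts: "finite (cuts p q)"
  by (rule finite_subset[of _ "intercalates \<times> free_rows"]) (auto simp: cuts_def finite_sets)

lemma finite_joins: "finite (joins k)"
  by (rule finite_subset[of _ "intercalates \<times> free_rows"]) (auto simp: joins_def linked_def finite_sets)

lemma card_le_times:
  assumes "inj_on f S" "f ` S \<subseteq> M \<times> (free_rows - {b})" "finite M"
  shows "card S \<le> (card free_rows - 1) * card M"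
proof -
  have "card S \<le> card (M \<times> (free_rows - {b}))" using assms finite_sets(5) by (intro card_inj_on_le) auto
  then show ?thesis using bU bR by (simp add: card_cartesian_product mult.commute free_rows_def)
qed

context
  fixes k assumes kU: "k \<in> U" and kC: "k \<notin> C" and ke: "k \<noteq> e"
begin

text \<open>Exchange columns \<open>e\<close> and \<open>k\<close> on the cycle of \<open>b\<close>, which avoids \<open>r\<close>. The symbol \<open>w\<close> moves to \<open>(b, k)\<close>.\<close>
lemma card_separated: "card (separated k) \<le> card (moved k)"
proof (rule card_inj_on_le[of "col_move e k b"])
  show "inj_on (col_move e k b) (separated k)"
    by (rule inj_on_inverseI[of _ "col_move e k b"])
      (use col_move(3)[OF _ eU kU ke[symmetric] bU] T_latin in \<open>auto simp: separated_def intercalates_def\<close>)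
  show "col_move e k b ` separated k \<subseteq> moved k"
  proof clarify
    fix L assume "L \<in> separated k"
    then obtain Z where L: "L \<in> T" "L b e = w" and Z: "closed_set (col L e) (col L k) Z" "b \<in> Z" "r \<notin> Z"
      by (auto simp: separated_def intercalates_def)
    have r: "r \<notin> component (col L e) (col L k) b" using component_least[OF Z(1,2)] Z(3) by blast
    note b = component_self[of b "col L e" "col L k"]
    have "col_move e k b L \<in> T"
      by (rule T_closed[OF L(1) col_move(1)[OF T_latin[OF L(1)] eU kU ke[symmetric] bU]])
        (use eC kC cC r in \<open>auto simp: col_move_outside intro!: col_move_other\<close>)
    moreover have "col_move e k b L b k = w" using col_move_inside(2)[OF b] ke L(2) by auto
    ultimately show "col_move e k b L \<in> moved k" by (simp add: moved_def)
  qed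
qed (rule finite_sets)

lemma separatedI:
  assumes "L \<in> intercalates" "closed_set (col L p) (col L q) Z" "b \<in> Z" "r \<notin> Z" "p = e \<and> q = k \<or> p = k \<and> q = e"
  shows "L \<in> separated k"
  using assms closed_set_sym[of "col L p" "col L q" Z] by (auto simp: separated_def)

text \<open>Let \<open>x\<close> be the neighbour of \<open>b\<close>. If some set of columns, closed for rows \<open>x\<close> and \<open>y\<close>, contains \<open>q\<close> but not \<open>p\<close>, exchanging the two rows there
  modifies column \<open>q\<close> only, among \<open>p\<close> and \<open>q\<close>: the arc from \<open>b\<close> to \<open>y\<close> together with \<open>x\<close> becomes a cycle of its own, without \<open>r\<close>.
  Otherwise rows \<open>x\<close> and \<open>y\<close> have a bridge from \<open>p\<close> to \<open>q\<close>, and the corner move exchanges columns \<open>p\<close> and \<open>q\<close> on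
  the arc, which moves \<open>w\<close> to \<open>(b, k)\<close>. In the first case \<open>x\<close> can be read off from the result and \<open>y\<close> has to be remembered,
  in the second case it is the other way round; either way at most \<open>card free_rows - 1\<close> squares have the
  same result.\<close>
lemma card_cuts:
  assumes pq: "p = e \<and> q = k \<or> p = k \<and> q = e"
  shows "card (cuts p q) \<le> (card free_rows - 1) * (card (separated k) + card (moved k))"
proof -
  define HD where "HD = {(L, y) \<in> cuts p q. \<exists>Z. closed_set (L (row_with L p (L b q))) (L y) Z \<and> q \<in> Z \<and> p \<notin> Z}"
  have pU: "p \<in> U" "q \<in> U" "p \<noteq> q" "p \<notin> C" "q \<notin> C" using pq eU kU ke eC kC by auto
  have facts: "latin L" "L \<in> T" "L b e = w" "y \<in> U" "y \<notin> R" "y \<noteq> b" "x \<in> U" "x \<notin> R" "x \<noteq> b" "x \<noteq> y" "L x p = L b q"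
      "L b q \<noteq> L y q"
    if "(L, y) \<in> cuts p q" "x = row_with L p (L b q)" for L x y
  proof -
    show l: "latin L" "L \<in> T" "L b e = w" "y \<in> U" "y \<notin> R" "y \<noteq> b" "x \<in> U" "x \<notin> R" "x \<noteq> y"
      using that T_latin by (auto simp: cuts_def intercalates_def free_rows_def)
    show lx: "L x p = L b q" using row_with(2)[OF l(1) pU(1) latin_mem[OF l(1) bU pU(2)]] that(2) by simp
    show "x \<noteq> b" using lx latin_row_eq[OF l(1) bU pU(1,2)] pU(3) by auto
    show "L b q \<noteq> L y q" using latin_col_eq[OF l(1) pU(2) bU l(4)] l(6) by auto
  qed
  have "card HD \<le> (card free_rows - 1) * card (separated k)"
  proof (rule card_le_times[of "\<lambda>(L, y). (row_move (row_with L p (L b q)) y q L, y)"])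
    have key: "row_move x y q L \<in> separated k \<and> row_with (row_move x y q L) p (row_move x y q L b q) = x \<and>
        row_move x y q (row_move x y q L) = L"
      if Ly: "(L, y) \<in> HD" and x: "x = row_with L p (L b q)" for L x y
    proof -
      have h: "(L, y) \<in> cuts p q" using Ly by (simp add: HD_def)
      note f = facts[OF h x]
      obtain Z where Z: "closed_set (L x) (L y) Z" "q \<in> Z" "p \<notin> Z" using Ly x by (auto simp: HD_def)
      obtain K where K: "bridge (col L p) (col L q) (L b q) (L y q) K" "r \<notin> K" using h by (auto simp: cuts_def)
      define M where "M = row_move x y q L"
      note rm = row_move[OF f(1,7,4,10) pU(2), folded M_def]
      have p: "p \<notin> component (L x) (L y) q" using component_least[OF Z(1,2)] Z(3) by blast
      note q = component_self[of q "L x" "L y"]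
      have Mp: "M i p = L i p" for i using row_move_outside[OF p] by (simp add: M_def)
      have Mo: "i \<noteq> x \<Longrightarrow> i \<noteq> y \<Longrightarrow> M i = L i" for i by (simp add: M_def row_move_other)
      have Mx: "M x q = L y q" using row_move_inside(1)[where L = L, OF q] by (simp add: M_def)
      have MR: "M i = L i" if "i \<in> R" for i
        by (rule Mo) (use that f(5,8) in auto)
      have "M \<in> T"
      proof (rule T_closed[OF f(2) rm(1)])
        show "M i j = L i j" if "i \<in> R" "j \<in> C" for i j using MR[OF that(1)] by simp
        show "M r e = L r e" using MR[OF rR] by simp
        show "M b c = L b c" using Mo[of b] f(6,9) by simp
      qed
      then have MY: "M \<in> intercalates" using Mo[of b] f by (simp add: intercalates_def)
      have xK: "x \<notin> K" "y \<notin> K" and KU: "K \<subseteq> U" using K(1) f(11) by (auto simp: bridge_def image_iff)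
      have "b \<in> K"
      proof -
        have "L b q \<in> (\<lambda>i. L i q) ` K" using K(1) f(12) by (auto simp: bridge_def)
        then show ?thesis using line_image_iff[OF latin_col[OF f(1) pU(2)] KU bU] by simp
      qed
      have e1: "col M p ` insert x K = insert (L b q) (col L p ` K)" using Mp f(11) by simp
      have e2: "col M q ` K = col L q ` K"
      proof (rule image_cong[OF refl])
        fix i assume "i \<in> K" then show "M i q = L i q" using Mo[of i] xK by (cases "i = x \<or> i = y") auto
      qed
      \<comment> \<open>the arc is cut off: in column \<open>q\<close> row \<open>x\<close> now holds the symbol that was missing on \<open>K\<close>\<close>
      have "closed_set (col M p) (col M q) (insert x K)"
        unfolding closed_set_def e1 using e2 Mx K(1) f(7) KU by (simp add: bridge_def)
      then have "M \<in> separated k"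
        by (rule separatedI[OF MY]) (use \<open>b \<in> K\<close> K(2) f(8) rR pq in auto)
      moreover have "row_with M p (M b q) = x"
        by (rule row_with_eqI[OF rm(1) pU(1) f(7)]) (use Mp Mo[of b] f in simp)
      ultimately show ?thesis using rm(3) by (simp add: M_def)
    qed
    show "inj_on (\<lambda>(L, y). (row_move (row_with L p (L b q)) y q L, y)) HD"
    proof (rule inj_on_inverseI[where g = "\<lambda>(M, y). (row_move (row_with M p (M b q)) y q M, y)"])
      fix v assume v: "v \<in> HD"
      obtain L y where p: "v = (L, y)" by (cases v)
      show "(\<lambda>(M, y). (row_move (row_with M p (M b q)) y q M, y))
          ((\<lambda>(L, y). (row_move (row_with L p (L b q)) y q L, y)) v) = v"
        using key[OF v[unfolded p] refl] p by simp
    qed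
    show "(\<lambda>(L, y). (row_move (row_with L p (L b q)) y q L, y)) ` HD \<subseteq> separated k \<times> (free_rows - {b})"
    proof clarify
      fix L y assume Ly: "(L, y) \<in> HD"
      then show "row_move (row_with L p (L b q)) y q L \<in> separated k \<and> y \<in> free_rows - {b}"
        using key[OF Ly refl] by (auto simp: HD_def cuts_def)
    qed
  qed (rule finite_sets)
  moreover have "card (cuts p q - HD) \<le> (card free_rows - 1) * card (moved k)"
  proof (rule card_le_times[of "\<lambda>(L, y). (corner_move (row_with L p (L b q)) y p q L, row_with L p (L b q))"])
    have key: "corner_move x y p q L \<in> moved k \<and> row_with (corner_move x y p q L) q (corner_move x y p q L b p) = y \<and>
        corner_move x y p q (corner_move x y p q L) = L"
      if Ly: "(L, y) \<in> cuts p q - HD" and x: "x = row_with L p (L b q)" for L x y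
    proof -
      have h: "(L, y) \<in> cuts p q" using Ly by simp
      note f = facts[OF h x]
      obtain K where K: "bridge (col L p) (col L q) (L b q) (L y q) K" "r \<notin> K" using h by (auto simp: cuts_def)
      have ne: "L x p \<noteq> L y q" using f by simp
      have "\<exists>K. bridge (L x) (L y) (L x p) (L y q) K"
        by (rule separating_or_bridge[OF f(1,7,4) pU(1,2) ne]) (use Ly x in \<open>auto simp: HD_def\<close>)
      then have cor: "cornered x y p q L" using f pU K(1) by (auto simp: cornered_def)
      define M where "M = corner_move x y p q L"
      define G where "G = least_bridge (col L p) (col L q) (L x p) (L y q)"
      note cm = corner_move[OF cor, folded M_def G_def]
      have "G \<subseteq> K" unfolding G_def f(11)
        by (rule least_bridge(2)[OF latin_col[OF f(1) pU(1)] latin_col[OF f(1) pU(2)] latin_mem[OF f(1) bU pU(2)]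
          latin_mem[OF f(1,4) pU(2)] f(12) K(1)])
      then have rG: "r \<notin> G" using K(2) by blast
      have bG: "b \<in> G"
      proof -
        have "L b q \<in> (\<lambda>i. L i q) ` G" using cm(2) f(11,12) by (auto simp: bridge_def)
        then show ?thesis using line_image_iff[OF latin_col[OF f(1) pU(2)] cm(8) bU] by simp
      qed
      have Mo: "M i j = L i j" if "i \<noteq> x" "i \<noteq> y" "j \<noteq> p \<and> j \<noteq> q \<or> i \<notin> G" for i j
        using that by (auto simp: M_def corner_move_def corner_swap_def G_def)
      have Mb: "M b p = L b q" "M b q = L b p"
        using bG f pU(3) by (auto simp: M_def corner_move_def corner_swap_def G_def)
      have Myq: "M y q = L b q" using f(10,11) by (auto simp: M_def corner_move_def corner_swap_def)
      have "M \<in> T"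
        by (rule T_closed[OF f(2) cm(9)], (rule Mo; use f pU cC rR rG in auto)+)
      moreover have "M b k = w" using pq Mb f(3) by auto
      moreover have "row_with M q (M b p) = y"
        by (rule row_with_eqI[OF cm(9) pU(2) f(4)]) (use Mb Myq in simp)
      ultimately show ?thesis using cm(10) by (simp add: moved_def M_def)
    qed
    show "inj_on (\<lambda>(L, y). (corner_move (row_with L p (L b q)) y p q L, row_with L p (L b q))) (cuts p q - HD)"
    proof (rule inj_on_inverseI[where g = "\<lambda>(M, x). (corner_move x (row_with M q (M b p)) p q M, row_with M q (M b p))"])
      fix v assume v: "v \<in> cuts p q - HD"
      obtain L y where p: "v = (L, y)" by (cases v)
      show "(\<lambda>(M, x). (corner_move x (row_with M q (M b p)) p q M, row_with M q (M b p)))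
          ((\<lambda>(L, y). (corner_move (row_with L p (L b q)) y p q L, row_with L p (L b q))) v) = v"
        using key[OF v[unfolded p] refl] p by simp
    qed
    show "(\<lambda>(L, y). (corner_move (row_with L p (L b q)) y p q L, row_with L p (L b q))) ` (cuts p q - HD) \<subseteq> moved k \<times> (free_rows - {b})"
    proof clarify
      fix L y assume Ly: "(L, y) \<in> cuts p q" "(L, y) \<notin> HD"
      then show "corner_move (row_with L p (L b q)) y p q L \<in> moved k \<and> row_with L p (L b q) \<in> free_rows - {b}"
        using key[OF _ refl, of L y] facts(9)[OF Ly(1) refl] by (auto simp: cuts_def)
    qed
  qed (rule finite_sets)
  moreover have "card (cuts p q) = card HD + card (cuts p q - HD)"
  proof -
    have sub: "HD \<subseteq> cuts p q" by (auto simp: HD_def)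
    show ?thesis
      using card_mono[OF finite_cuts sub] card_Diff_subset[OF finite_subset[OF sub finite_cuts] sub] by simp
  qed
  ultimately show ?thesis by (simp add: distrib_left)
qed

text \<open>Exchanging rows \<open>x\<close> and \<open>y\<close> in column \<open>k\<close> but not in column \<open>e\<close> inserts the cycle of \<open>y\<close>
  next to \<open>x\<close>, on the side away from \<open>b\<close>. In the result \<open>y\<close> is reached from \<open>b\<close> through \<open>x\<close> and then the
  inserted cycle. This arc does not meet \<open>r\<close>, so \<open>y\<close> is a cut in the direction that starts with \<open>x\<close>.\<close>
lemma join_is_cut:
  assumes L: "L \<in> linked k" and x: "x = row_with L e (L b k)" and y: "y \<in> free_rows - {b, x}"
    and Z: "closed_set (col L e) (col L k) Z" "b \<in> Z" "y \<notin> Z"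
    and S: "closed_set (L x) (L y) S" "k \<in> S" "e \<notin> S"
  shows "(row_move x y k L, y) \<in> cuts k e"
    "row_with (row_move x y k L) e (row_move x y k L b k) = x"
    "row_move x y k (row_move x y k L) = L"
proof -
  have LT: "L \<in> T" "L b e = w" and LB: "L \<notin> separated k" and LY: "L \<in> intercalates" and xW: "x \<in> free_rows" and x'free_rows: "row_with L k w \<in> free_rows"
    using L x by (auto simp: linked_def intercalates_def)
  have l: "latin L" using T_latin LT by simp
  have wU: "w \<in> U" using latin_mem[OF l bU eU] LT by simp
  have xU: "x \<in> U" "x \<notin> R" and yU: "y \<in> U" "y \<notin> R" "y \<noteq> b" "y \<noteq> x" using xW y by (auto simp: free_rows_def)
  have xe: "L x e = L b k" using row_with(2)[OF l eU latin_mem[OF l bU kU]] x by simp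
  have xb: "x \<noteq> b" using xe latin_row_eq[OF l bU eU kU] ke by auto
  define x' where "x' = row_with L k w"
  have x'U: "x' \<in> U" "L x' k = w" using row_with[OF l kU wU] by (auto simp: x'_def)
  have x'b: "x' \<noteq> b" using x'U latin_row_eq[OF l bU eU kU] ke LT by auto
  define M where "M = row_move x y k L"
  note rm = row_move[OF l xU(1) yU(1) yU(4)[symmetric] kU, folded M_def]
  show "row_move x y k (row_move x y k L) = L" using rm(3) by (simp add: M_def)
  have e: "e \<notin> component (L x) (L y) k" using component_least[OF S(1,2)] S(3) by blast
  note k = component_self[of k "L x" "L y"]
  have Me: "M i e = L i e" for i using row_move_outside[OF e] by (simp add: M_def)
  have Mo: "i \<noteq> x \<Longrightarrow> i \<noteq> y \<Longrightarrow> M i = L i" for i by (simp add: M_def row_move_other)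
  have Mk: "M x k = L y k" "M y k = L x k" using row_move_inside[where L = L, OF k] by (auto simp: M_def)
  have MR: "M i = L i" if "i \<in> R" for i by (rule Mo) (use that xU yU in auto)
  have "M \<in> T"
  proof (rule T_closed[OF LT(1) rm(1)])
    show "M i j = L i j" if "i \<in> R" "j \<in> C" for i j using MR[OF that(1)] by simp
    show "M r e = L r e" using MR[OF rR] by simp
    show "M b c = L b c" using Mo[of b] xb yU by simp
  qed
  then have MY: "M \<in> intercalates" using Me LT by (simp add: intercalates_def)
  show "row_with (row_move x y k L) e (row_move x y k L b k) = x"
    unfolding M_def[symmetric]
    by (rule row_with_eqI[OF rm(1) eU xU(1)]) (use Me xe Mo[of b] xb yU in simp)
  define V where "V = U - Z"
  have V: "closed_set (col L e) (col L k) V" "b \<notin> V" "y \<in> V"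
    using closed_set_compl[OF latin_col[OF l eU] latin_col[OF l kU] Z(1)] Z yU by (auto simp: V_def)
  have VU: "V \<subseteq> U" by (auto simp: V_def)
  have sep: "r \<in> Z'" if "closed_set (col L e) (col L k) Z'" "b \<in> Z'" for Z'
    using LB LY that by (auto simp: separated_def)
  note cl = V(1)[unfolded closed_set_iff[OF latin_col[OF l eU] latin_col[OF l kU]]]
  have xV: "x \<notin> V" using cl xU bU V(2) xe by blast
  have x'V: "x' \<notin> V" using cl x'U bU V(2) LT(2) by metis
  have rV: "r \<notin> V" using sep[OF Z(1,2)] by (simp add: V_def)
  have x'x: "x' \<noteq> x"
  proof
    assume "x' = x"
    have "closed_set (col L e) (col L k) {b, x}"
      using xe x'U LT(2) \<open>x' = x\<close> bU xU(1) by (auto simp: closed_set_def)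
    then show False using sep[of "{b, x}"] xU(2) bR rR by auto
  qed
  have x'y: "x' \<noteq> y" using x'V V(3) by auto
  have rx': "row_with M k (M b e) = x'"
    by (rule row_with_eqI[OF rm(1) kU x'U(1)]) (use Mo[of x'] x'x x'y x'U Me LT in simp)
  \<comment> \<open>the arc from \<open>b\<close> through \<open>x\<close> and the cycle of \<open>y\<close>; \<open>V\<close> may contain further cycles, but avoids \<open>b\<close> and \<open>r\<close>\<close>
  define K where "K = insert b (insert x (V - {y}))"
  have "bridge (col M k) (col M e) (M b e) (M y e) K"
    unfolding bridge_def
  proof (intro conjI)
    show KU: "K \<subseteq> U" using bU xU VU by (auto simp: K_def)
    have ek: "col M k ` K = insert (L b k) (insert (L y k) (col L k ` (V - {y})))"
    proof -
      have "col M k ` (V - {y}) = col L k ` (V - {y})"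
      proof (rule image_cong[OF refl])
        fix i assume "i \<in> V - {y}" then show "M i k = L i k" using Mo[of i] xV by (cases "i = x") auto
      qed
      then show ?thesis using Mk Mo[of b] xb yU unfolding K_def by simp
    qed
    also have "insert (L y k) (col L k ` (V - {y})) = col L k ` V" using V(3) by blast
    finally have ek: "col M k ` K = insert (L b k) (col L k ` V)" .
    have ee: "col M e ` K = insert w (insert (L b k) (col L e ` (V - {y})))"
    proof -
      have "col M e = col L e" using Me by (simp add: fun_eq_iff)
      then have "col M e ` K = insert (L b e) (insert (L x e) (col L e ` (V - {y})))"
        unfolding K_def by (simp only: image_insert)
      then show ?thesis by (simp only: LT xe)
    qed
    have "insert (M y e) (insert w (insert (L b k) (col L e ` (V - {y})))) = insert w (insert (L b k) (col L e ` V))"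
    proof -
      have "insert (L y e) (col L e ` (V - {y})) = col L e ` V" using V(3) by blast
      moreover have "insert a (insert w (insert (L b k) S)) = insert w (insert (L b k) (insert a S))" for a S by blast
      ultimately show ?thesis unfolding Me by (simp only:)
    qed
    then show "insert (M b e) (col M k ` K) = insert (M y e) (col M e ` K)"
      unfolding ek ee using V(1) LT Me by (simp add: closed_set_def)
    show "M b e \<notin> col M k ` K"
    proof
      assume "M b e \<in> col M k ` K"
      then have "w \<in> insert (L b k) (col L k ` V)" using ek Me LT by simp
      moreover have "w \<noteq> L b k" using LT latin_row_eq[OF l bU eU kU] ke by auto
      ultimately have "L x' k \<in> col L k ` V" using x'U by simp
      then show False using line_image_iff[OF latin_col[OF l kU] VU x'U(1)] x'V by simp
    qed
    have "y \<notin> K" using yU by (auto simp: K_def)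
    then show "M y e \<notin> col M e ` K" using line_image_iff[OF latin_col[OF rm(1) eU] KU yU(1)] by simp
  qed
  moreover have "r \<notin> K" using rV xU bR rR by (auto simp: K_def)
  ultimately show "(row_move x y k L, y) \<in> cuts k e"
    unfolding M_def[symmetric] cuts_def using MY y rx' x'y x'free_rows by (auto simp: x'_def)
qed

text \<open>If no closed set for rows \<open>x\<close> and \<open>y\<close> contains \<open>k\<close> and not \<open>e\<close>, then exchanging columns \<open>e\<close> and \<open>k\<close>
  on the cycle of \<open>y\<close> transposes the entries of row \<open>y\<close> in these columns and not those of row \<open>x\<close>. This
  splits the common cycle of \<open>e\<close> and \<open>k\<close>, so that afterwards such a closed set exists. The factor 2 counts the two cases.\<close>
lemma card_joins: "card (joins k) \<le> 2 * card (cuts k e)"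
proof -
  define O1 where "O1 = {(L, y) \<in> joins k. \<exists>S. closed_set (L (row_with L e (L b k))) (L y) S \<and> k \<in> S \<and> e \<notin> S}"
  have "card O1 \<le> card (cuts k e)"
  proof (rule card_inj_on_le[of "\<lambda>(L, y). (row_move (row_with L e (L b k)) y k L, y)"])
    have key: "(row_move x y k L, y) \<in> cuts k e \<and>
      row_with (row_move x y k L) e (row_move x y k L b k) = x \<and> row_move x y k (row_move x y k L) = L"
      if Ly: "(L, y) \<in> O1" and x: "x = row_with L e (L b k)" for L x y
    proof -
      obtain Z S where "closed_set (col L e) (col L k) Z" "b \<in> Z" "y \<notin> Z" "closed_set (L x) (L y) S" "k \<in> S" "e \<notin> S"
        "L \<in> linked k" "y \<in> free_rows - {b, x}"
        using Ly unfolding O1_def joins_def x by (simp, blast)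
      then show ?thesis using join_is_cut[of L x y Z S] x by auto
    qed
    show "inj_on (\<lambda>(L, y). (row_move (row_with L e (L b k)) y k L, y)) O1"
    proof (rule inj_on_inverseI[where g = "\<lambda>(M, y). (row_move (row_with M e (M b k)) y k M, y)"])
      fix v assume v: "v \<in> O1"
      obtain L y where p: "v = (L, y)" by (cases v)
      show "(\<lambda>(M, y). (row_move (row_with M e (M b k)) y k M, y))
          ((\<lambda>(L, y). (row_move (row_with L e (L b k)) y k L, y)) v) = v"
        using key[OF v[unfolded p] refl] p by simp
    qed
    have "(row_move (row_with L e (L b k)) y k L, y) \<in> cuts k e" if "(L, y) \<in> O1" for L y
      using key[OF that refl] by blast
    then    show "(\<lambda>(L, y). (row_move (row_with L e (L b k)) y k L, y)) ` O1 \<subseteq> cuts k e"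
      by auto
  qed (rule finite_cuts)
  moreover have "card (joins k - O1) \<le> card O1"
  proof (rule card_inj_on_le[of "\<lambda>(L, y). (col_move e k y L, y)"])
    have key: "(col_move e k y L, y) \<in> O1 \<and> col_move e k y (col_move e k y L) = L"
      if Ly: "(L, y) \<in> joins k - O1" for L y
    proof -
      define x where "x = row_with L e (L b k)"
      obtain Z where Z: "closed_set (col L e) (col L k) Z" "b \<in> Z" "y \<notin> Z"
        and L: "L \<in> linked k" and y: "y \<in> free_rows - {b, x}"
        using Ly by (auto simp: joins_def x_def)
      have no: "\<nexists>S. closed_set (L x) (L y) S \<and> k \<in> S \<and> e \<notin> S" using Ly by (auto simp: O1_def x_def)
      have LT: "L \<in> T" "L b e = w" and LB: "L \<notin> separated k" and LY: "L \<in> intercalates" and xW: "x \<in> free_rows" and x'free_rows: "row_with L k w \<in> free_rows"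
        using L x_def by (auto simp: linked_def intercalates_def)
      have l: "latin L" using T_latin LT by simp
      have wU: "w \<in> U" using latin_mem[OF l bU eU] LT by simp
      have xU: "x \<in> U" "x \<notin> R" and yU: "y \<in> U" "y \<notin> R" "y \<noteq> b" "y \<noteq> x" using xW y by (auto simp: free_rows_def)
      have xe: "L x e = L b k" using row_with(2)[OF l eU latin_mem[OF l bU kU]] x_def by simp
      define x' where "x' = row_with L k w"
      have x'U: "x' \<in> U" "L x' k = w" using row_with[OF l kU wU] by (auto simp: x'_def)
      define M where "M = col_move e k y L"
      note cm = col_move[OF l eU kU ke[symmetric] yU(1), folded M_def]
      define V where "V = component (col L e) (col L k) y"
      have V: "closed_set (col L e) (col L k) V" "y \<in> V" using component_closed[OF latin_col[OF l eU] latin_col[OF l kU] yU(1)] component_self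
        by (auto simp: V_def)
      have VU: "V \<subseteq> U" using V(1) by (simp add: closed_set_def)
      have "V \<subseteq> U - Z" unfolding V_def
        by (rule component_least[OF closed_set_compl[OF latin_col[OF l eU] latin_col[OF l kU] Z(1)]]) (use Z yU in auto)
      then have bV: "b \<notin> V" using Z by blast
      have sep: "r \<in> Z'" if "closed_set (col L e) (col L k) Z'" "b \<in> Z'" for Z'
        using LB LY that by (auto simp: separated_def)
      have rV: "r \<notin> V" using sep[OF Z(1,2)] \<open>V \<subseteq> U - Z\<close> by blast
      note cl = V(1)[unfolded closed_set_iff[OF latin_col[OF l eU] latin_col[OF l kU]]]
      have xV: "x \<notin> V" using cl xU bU bV xe by blast
      have x'V: "x' \<notin> V" using cl x'U bU bV LT(2) by metis
      have Mo: "i \<notin> V \<Longrightarrow> M i = L i" for i by (simp add: M_def V_def col_move_outside)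
      have Mj: "j \<noteq> e \<Longrightarrow> j \<noteq> k \<Longrightarrow> M i j = L i j" for i j by (simp add: M_def col_move_other)
      have My: "M y e = L y k" "M y k = L y e"
        using col_move_inside[OF V(2)[unfolded V_def] ke[symmetric]] by (auto simp: M_def)
      have "M \<in> T"
      proof (rule T_closed[OF LT(1) cm(1)])
        show "M i j = L i j" if "i \<in> R" "j \<in> C" for i j by (rule Mj) (use that eC kC in auto)
        show "M r e = L r e" using Mo[OF rV] by simp
        show "M b c = L b c" using Mo[OF bV] by simp
      qed
      then have MY: "M \<in> intercalates" using Mo[OF bV] LT by (simp add: intercalates_def)
      have rx: "row_with M e (M b k) = x"
        by (rule row_with_eqI[OF cm(1) eU xU(1)]) (use Mo[OF bV] Mo[OF xV] xe in simp)
      have rx': "row_with M k w = x'"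
        by (rule row_with_eqI[OF cm(1) kU x'U(1)]) (use Mo[OF x'V] x'U in simp)
      have "M \<notin> separated k" using sep cm(2) by (auto simp: separated_def)
      then have "M \<in> linked k" using MY rx rx' xW x'free_rows by (auto simp: linked_def x'_def)
      moreover have "closed_set (col M e) (col M k) Z" using cm(2) Z by simp
      ultimately have "(M, y) \<in> joins k" using Z y rx by (auto simp: joins_def)
      moreover have "\<exists>S. closed_set (M x) (M y) S \<and> k \<in> S \<and> e \<notin> S"
      proof (cases "L x k = L y e")
        case True
        then have "closed_set (M x) (M y) {k}" using Mo[OF xV] My kU by (simp add: closed_set_def)
        then show ?thesis using ke by blast
      next
        case False
        have "\<nexists>S. closed_set (L x) (L y) S \<and> e \<in> S \<and> k \<notin> S"
        proof
          assume "\<exists>S. closed_set (L x) (L y) S \<and> e \<in> S \<and> k \<notin> S"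
          then obtain S where S: "closed_set (L x) (L y) S" "e \<in> S" "k \<notin> S" by blast
          then have "closed_set (L x) (L y) (U - S)"
            using closed_set_compl[OF latin_row[OF l xU(1)] latin_row[OF l yU(1)]] by blast
          then show False using no S kU by blast
        qed
        then obtain K where K: "bridge (L x) (L y) (L x k) (L y e) K"
          using separating_or_bridge[OF l xU(1) yU(1) kU eU False] by blast
        have KU: "K \<subseteq> U" and kK: "k \<notin> K" and eK: "e \<notin> K" using K by (auto simp: bridge_def)
        have "M x ` insert k K = insert (L x k) (L x ` K)" using Mo[OF xV] by simp
        moreover have "M y ` insert k K = insert (L y e) (L y ` K)"
        proof -
          have "M y ` K = L y ` K"
          proof (rule image_cong[OF refl])
            fix j assume "j \<in> K" then show "M y j = L y j" using Mj[of j y] kK eK by (cases "j = e \<or> j = k") auto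
          qed
          then show ?thesis using My by simp
        qed
        ultimately have "closed_set (M x) (M y) (insert k K)"
          using K KU kU by (simp add: closed_set_def bridge_def)
        then show ?thesis using eK ke by blast
      qed
      ultimately show ?thesis using cm(3) rx by (auto simp: O1_def M_def)
    qed
    show "inj_on (\<lambda>(L, y). (col_move e k y L, y)) (joins k - O1)"
      by (rule inj_on_inverseI[where g = "\<lambda>(M, y). (col_move e k y M, y)"]) (use key in \<open>auto split: prod.splits\<close>)
    show "(\<lambda>(L, y). (col_move e k y L, y)) ` (joins k - O1) \<subseteq> O1" using key by auto
    show "finite O1" by (rule finite_subset[OF _ finite_joins[of k]]) (auto simp: O1_def)
  qed
  moreover have "card (joins k) = card O1 + card (joins k - O1)"
  proof -
    have sub: "O1 \<subseteq> joins k" by (auto simp: O1_def)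
    show ?thesis
      using card_mono[OF finite_joins sub] card_Diff_subset[OF finite_subset[OF sub finite_joins] sub] by simp
  qed
  ultimately show ?thesis by simp
qed

text \<open>A row \<open>y\<close> on the cycle of \<open>b\<close> and \<open>r\<close> is reached from \<open>b\<close> by two arcs, and \<open>r\<close> is on only one of
  them; a row off the cycle gives a join. The neighbour of \<open>b\<close> that the
  definition of \<open>cuts k e\<close> excludes is treated separately: it belongs to \<open>cuts e k\<close>, with the arc \<open>{b}\<close>.\<close>
lemma linked_cover:
  assumes L: "L \<in> linked k" and y: "y \<in> free_rows - {b, row_with L e (L b k)}"
  shows "(L, y) \<in> cuts e k \<union> cuts k e \<union> joins k"
proof (cases "\<exists>Z. closed_set (col L e) (col L k) Z \<and> b \<in> Z \<and> y \<notin> Z")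
  case True
  then have "(L, y) \<in> joins k" using L y by (simp add: joins_def)
  then show ?thesis by blast
next
  case no: False
  have LT: "L \<in> T" "L b e = w" and LY: "L \<in> intercalates" and xW: "row_with L e (L b k) \<in> free_rows" and x'free_rows: "row_with L k w \<in> free_rows"
    using L by (auto simp: linked_def intercalates_def)
  have l: "latin L" using T_latin LT by simp
  have wU: "w \<in> U" using latin_mem[OF l bU eU] LT by simp
  have yU: "y \<in> U" "y \<noteq> b" using y by (auto simp: free_rows_def)
  have ne: "L b e \<noteq> L b k" using latin_row_eq[OF l bU eU kU] ke by auto
  have nk: "L b k \<noteq> L y k" using latin_col_eq[OF l kU bU yU(1)] yU(2) by auto
  note f = latin_col[OF l eU] and g = latin_col[OF l kU]
  show ?thesis
  proof (cases "y = row_with L k w")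
    case True
    then have yk: "L y k = w" using row_with(2)[OF l kU wU] by simp
    have "bridge (col L e) (col L k) (L b k) (L y k) {b}"
      using bU ne LT by (auto simp: bridge_def yk)
    then have "(L, y) \<in> cuts e k" using LY y xW rR bR by (auto simp: cuts_def)
    then show ?thesis by blast
  next
    case yx': False
    obtain K where K: "bridge (col L e) (col L k) (L b k) (L y k) K"
    proof (cases "\<exists>K. bridge (col L e) (col L k) (L b k) (L y k) K")
      case False
      then obtain Z where Z: "closed_set (col L e) (col L k) Z" "L y k \<in> col L e ` Z" "L b k \<notin> col L e ` Z"
        using bridge_or_closed[OF f g latin_mem[OF l bU kU] latin_mem[OF l yU(1) kU] nk] by blast
      have ZU: "Z \<subseteq> U" and eq: "col L e ` Z = col L k ` Z" using Z(1) by (auto simp: closed_set_def)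
      have "y \<in> Z" using Z(2) line_image_iff[OF g ZU yU(1)] unfolding eq by simp
      moreover have "b \<notin> Z" using Z(3) line_image_iff[OF g ZU bU] unfolding eq by simp
      ultimately have "closed_set (col L e) (col L k) (U - Z) \<and> b \<in> U - Z \<and> y \<notin> U - Z"
        using closed_set_compl[OF f g Z(1)] bU by blast
      then show thesis using no by blast
    qed blast
    show ?thesis
    proof (cases "r \<in> K")
      case False
      then have "(L, y) \<in> cuts e k" using LY y xW K by (auto simp: cuts_def)
      then show ?thesis by blast
    next
      case True
      have "bridge (col L k) (col L e) (L b e) (L y e) (insert b (U - K - {y}))"
        using bridge_complement[OF f g bU yU ne K] .
      moreover have "r \<notin> insert b (U - K - {y})" using True rR bR by auto
      ultimately have "(L, y) \<in> cuts k e" using LY y x'free_rows yx' LT unfolding cuts_def by auto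
      then show ?thesis by blast
    qed
  qed
qed

text \<open>With \<open>m = card free_rows\<close>, each square in \<open>linked k\<close> gives \<open>m - 2\<close> cuts or joins. There are two kinds of
  cuts, and the joins count twice one of them, so \<open>4 (m - 1) (card (separated k) + card (moved k))\<close> bounds the total. As \<open>b\<close> has two distinct neighbours among the
  free rows, \<open>m \<ge> 3\<close> and \<open>m - 1 \<le> 2 (m - 2)\<close>, and the \<open>16\<close> follows from \<open>card_separated\<close>, whose own contribution
  makes it \<open>17\<close>.\<close>
lemma card_linked_separated: "card (linked k) + card (separated k) \<le> 17 * card (moved k)"
proof (cases "linked k = {}")
  case True
  then show ?thesis using card_separated by simp
next
  case False
  have W2: "card (free_rows - {b, row_with L e (L b k)}) = card free_rows - 2" if "L \<in> linked k" for L
  proof -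
    have LT: "L \<in> T" and xW: "row_with L e (L b k) \<in> free_rows" using that by (auto simp: linked_def intercalates_def)
    have l: "latin L" using T_latin LT by simp
    have "L (row_with L e (L b k)) e = L b k" using row_with(2)[OF l eU latin_mem[OF l bU kU]] .
    then have "row_with L e (L b k) \<noteq> b" using latin_row_eq[OF l bU eU kU] ke by auto
    then have "card {b, row_with L e (L b k)} = 2" by simp
    then show ?thesis using card_Diff_subset[of "{b, row_with L e (L b k)}" free_rows] xW bU bR by (simp add: free_rows_def)
  qed
  have W3: "3 \<le> card free_rows"
  proof -
    obtain L where L: "L \<in> linked k" using False by blast
    define x x' where "x = row_with L e (L b k)" and "x' = row_with L k w"
    have LT: "L \<in> T" "L b e = w" "L \<in> intercalates" "L \<notin> separated k" and xW: "x \<in> free_rows" "x' \<in> free_rows" using L by (auto simp: linked_def intercalates_def x_def x'_def)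
    have l: "latin L" using T_latin LT by simp
    have wU: "w \<in> U" using latin_mem[OF l bU eU] LT by simp
    have xe: "L x e = L b k" using row_with(2)[OF l eU latin_mem[OF l bU kU]] by (simp add: x_def)
    have x'k: "L x' k = w" using row_with(2)[OF l kU wU] by (simp add: x'_def)
    have "x \<noteq> b" "x' \<noteq> b" using xe x'k LT latin_row_eq[OF l bU eU kU] ke by auto
    moreover have "x \<noteq> x'"
    proof
      assume "x = x'"
      then have "closed_set (col L e) (col L k) {b, x}" using xe x'k LT bU xW by (auto simp: closed_set_def free_rows_def)
      then have "L \<in> separated k" using LT xW rR bR by (auto simp: separated_def free_rows_def)
      then show False using LT by simp
    qed
    ultimately have "card {b, x, x'} = 3" by simp
    moreover have "{b, x, x'} \<subseteq> free_rows" using xW bU bR by (auto simp: free_rows_def)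
    ultimately show ?thesis using card_mono[OF finite_sets(5)] by metis
  qed
  let ?S = "card (separated k) + card (moved k)"
  have "card (linked k) * (card free_rows - 2) = card (SIGMA L:linked k. free_rows - {b, row_with L e (L b k)})"
    using W2 finite_sets by (subst card_SigmaI) auto
  also have "\<dots> \<le> card (cuts e k \<union> cuts k e \<union> joins k)"
    using linked_cover finite_cuts finite_joins by (intro card_mono) auto
  also have "\<dots> \<le> card (cuts e k) + card (cuts k e) + card (joins k)"
    by (meson card_Un_le le_trans add_le_mono1)
  also have "\<dots> \<le> card (cuts e k) + 3 * card (cuts k e)" using card_joins by simp
  also have "\<dots> \<le> 4 * ((card free_rows - 1) * ?S)"
    using card_cuts[of e k] card_cuts[of k e] by simp
  also have "\<dots> \<le> 4 * ((card free_rows - 1) * (2 * card (moved k)))"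
    using card_separated by simp
  also have "\<dots> \<le> 4 * ((2 * (card free_rows - 2)) * (2 * card (moved k)))"
    using W3 by (intro mult_le_mono) auto
  finally have "card (linked k) * (card free_rows - 2) \<le> (16 * card (moved k)) * (card free_rows - 2)" by simp
  then have "card (linked k) \<le> 16 * card (moved k)" using W3 by simp
  then show ?thesis using card_separated by simp
qed

end

text \<open>A column \<open>k\<close> is bad only if one of the two neighbours of \<open>b\<close> is in \<open>R\<close>. On either side, distinct \<open>k\<close> give
  distinct neighbours. None of them is \<open>r\<close>: this would force \<open>L b k = u\<close> or \<open>L r k = w\<close>, but these symbols
  occur in their rows in column \<open>c\<close>. Hence each side excludes at most \<open>card R - 1\<close> columns.\<close>
lemma many_good_columns:
  assumes L: "L \<in> intercalates"
  shows "card U + 1 \<le> card {k \<in> U - C - {e}. L \<in> linked k \<union> separated k} + card C + 2 * card R"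
proof -
  have LT: "L \<in> T" "L b e = w" using L by (auto simp: intercalates_def)
  have l: "latin L" using T_latin LT by simp
  have wU: "w \<in> U" using latin_mem[OF l bU eU] LT by simp
  note pins = T_pins[OF LT(1)]
  define V where "V = U - C - {e}"
  define B1 where "B1 = {k \<in> V. row_with L e (L b k) \<in> R}"
  define B2 where "B2 = {k \<in> V. row_with L k w \<in> R}"
  have finV: "finite V" "finite C" "finite R" using fin RU CU by (auto simp: V_def intro: finite_subset)
  have cV: "card V + card C + 1 = card U"
  proof -
    have "card (U - C) = card U - card C" using card_Diff_subset[OF finV(2) CU] .
    moreover have "card V = card (U - C) - 1" using eU eC by (simp add: V_def)
    moreover have "card C \<le> card U" using card_mono[OF fin CU] .
    moreover have "0 < card (U - C)" using eU eC fin by (auto simp: card_gt_0_iff)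
    ultimately show ?thesis by linarith
  qed
  have R0: "card (R - {r}) + 1 = card R" using card_Suc_Diff1[OF finV(3) rR] by simp
  have b1: "card B1 \<le> card (R - {r})"
  proof (rule card_inj_on_le[of "\<lambda>k. row_with L e (L b k)"])
    have ent: "L (row_with L e (L b k)) e = L b k" if "k \<in> V" for k
      using row_with(2)[OF l eU latin_mem[OF l bU]] that unfolding V_def by blast
    show "inj_on (\<lambda>k. row_with L e (L b k)) B1"
    proof (rule inj_onI)
      fix k k' assume k: "k \<in> B1" "k' \<in> B1" "row_with L e (L b k) = row_with L e (L b k')"
      have kV: "k \<in> V" "k' \<in> V" using k by (auto simp: B1_def)
      have "L b k = L (row_with L e (L b k)) e" using ent[OF kV(1)] by (rule sym)
      also have "\<dots> = L (row_with L e (L b k')) e" by (simp only: k(3))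
      also have "\<dots> = L b k'" by (rule ent[OF kV(2)])
      finally show "k = k'" using latin_row_eq[OF l bU, of k k'] kV by (simp add: V_def)
    qed
    show "(\<lambda>k. row_with L e (L b k)) ` B1 \<subseteq> R - {r}"
    proof clarify
      fix k assume k: "k \<in> B1"
      have "row_with L e (L b k) \<noteq> r"
      proof
        assume "row_with L e (L b k) = r"
        then have "L b k = L r e" using ent[of k] k by (auto simp: B1_def)
        then have "L b k = L b c" using pins by simp
        then show False using latin_row_eq[OF l bU _ elems(2), of k] k cC by (auto simp: B1_def V_def)
      qed
      then show "row_with L e (L b k) \<in> R - {r}" using k by (simp add: B1_def)
    qed
  qed (use finV in simp)
  have b2: "card B2 \<le> card (R - {r})"
  proof (rule card_inj_on_le[of "\<lambda>k. row_with L k w"])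
    have ent: "L (row_with L k w) k = w" "row_with L k w \<in> U" if "k \<in> V" for k
      using row_with[OF l _ wU] that by (auto simp: V_def)
    show "inj_on (\<lambda>k. row_with L k w) B2"
    proof (rule inj_onI)
      fix k k' assume k: "k \<in> B2" "k' \<in> B2" "row_with L k w = row_with L k' w"
      have kV: "k \<in> V" "k' \<in> V" using k by (auto simp: B2_def)
      have "L (row_with L k w) k = L (row_with L k' w) k'" using ent(1)[OF kV(1)] ent(1)[OF kV(2)] by (rule trans[OF _ sym])
      also have "\<dots> = L (row_with L k w) k'" by (simp only: k(3))
      finally show "k = k'" using latin_row_eq[OF l ent(2)[OF kV(1)], of k k'] kV by (simp add: V_def)
    qed
    show "(\<lambda>k. row_with L k w) ` B2 \<subseteq> R - {r}"
    proof clarify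
      fix k assume k: "k \<in> B2"
      have "row_with L k w \<noteq> r"
      proof
        assume "row_with L k w = r"
        then have "L r k = w" using ent(1)[of k] k by (auto simp: B2_def)
        then have "L r k = L r c" using pins by simp
        then show False using latin_row_eq[OF l elems(1) _ elems(2), of k] k cC by (auto simp: B2_def V_def)
      qed
      then show "row_with L k w \<in> R - {r}" using k by (simp add: B2_def)
    qed
  qed (use finV in simp)
  have "V \<subseteq> {k \<in> V. L \<in> linked k \<union> separated k} \<union> B1 \<union> B2"
  proof
    fix k assume k: "k \<in> V"
    have "row_with L e (L b k) \<in> U" "row_with L k w \<in> U"
      using row_with(1)[OF l eU latin_mem[OF l bU]] row_with(1)[OF l _ wU] k by (auto simp: V_def)
    then show "k \<in> {k \<in> V. L \<in> linked k \<union> separated k} \<union> B1 \<union> B2"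
      using k L by (auto simp: linked_def B1_def B2_def free_rows_def)
  qed
  then have "card V \<le> card ({k \<in> V. L \<in> linked k \<union> separated k} \<union> B1 \<union> B2)"
    using finV by (intro card_mono) (auto simp: B1_def B2_def)
  also have "\<dots> \<le> card {k \<in> V. L \<in> linked k \<union> separated k} + card B1 + card B2"
    by (meson card_Un_le le_trans add_le_mono1)
  finally show ?thesis using cV b1 b2 R0 by (simp add: V_def)
qed

text \<open>Each square with the intercalate has at least \<open>G\<close> columns \<open>k\<close> into which \<open>w\<close> can be moved, while the sets
  \<open>moved k\<close> are disjoint subsets of \<open>T\<close>.\<close>
lemma card_intercalates:
  assumes G: "G + card C + 2 * card R \<le> card U + 1"
  shows "G * card intercalates \<le> 17 * card T"
proof -
  define V where "V = U - C - {e}"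
  have finV: "finite V" using fin by (simp add: V_def)
  have "G * card intercalates = (\<Sum>L\<in>intercalates. G)" by simp
  also have "\<dots> \<le> (\<Sum>L\<in>intercalates. card {k \<in> V. L \<in> linked k \<union> separated k})"
    using many_good_columns G by (intro sum_mono) (fastforce simp: V_def)
  also have "\<dots> = card (SIGMA L:intercalates. {k \<in> V. L \<in> linked k \<union> separated k})"
    using finite_sets finV by simp
  also have "\<dots> \<le> card (SIGMA k:V. linked k \<union> separated k)"
    by (rule card_inj_on_le[of "\<lambda>(L, k). (k, L)"]) (use finV finite_sets in \<open>auto simp: inj_on_def\<close>)
  also have "\<dots> = (\<Sum>k\<in>V. card (linked k \<union> separated k))" using finite_sets finV by simp
  also have "\<dots> \<le> (\<Sum>k\<in>V. 17 * card (moved k))"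
  proof (rule sum_mono)
    fix k assume "k \<in> V"
    then show "card (linked k \<union> separated k) \<le> 17 * card (moved k)"
      using card_linked_separated[of k] card_Un_le[of "linked k" "separated k"] by (auto simp: V_def)
  qed
  also have "\<dots> = 17 * card (SIGMA k:V. moved k)" using finite_sets finV by (simp add: sum_distrib_left)
  also have "card (SIGMA k:V. moved k) \<le> card T"
  proof (rule card_inj_on_le[of snd])
    show "inj_on snd (SIGMA k:V. moved k)"
    proof (rule inj_onI, clarsimp)
      fix k k' L assume "k \<in> V" "k' \<in> V" "L \<in> moved k" "L \<in> moved k'"
      then show "k = k'" using latin_row_eq[OF T_latin bU, of L k k'] by (auto simp: moved_def V_def)
    qed
  qed (auto simp: moved_def finite_T)
  finally show ?thesis by simp
qed

end

section \<open>Switching the entry of one cell\<close>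

lemma sum_card_disjoint_le:
  assumes "finite I" "finite M" "\<And>i. i \<in> I \<Longrightarrow> S i \<subseteq> M"
    and "\<And>i j x. i \<in> I \<Longrightarrow> j \<in> I \<Longrightarrow> x \<in> S i \<Longrightarrow> x \<in> S j \<Longrightarrow> i = j"
  shows "(\<Sum>i\<in>I. card (S i)) \<le> card M"
proof -
  have fS: "finite (S i)" if "i \<in> I" for i using assms(2,3) that finite_subset by blast
  have "(\<Sum>i\<in>I. card (S i)) = card (\<Union>i\<in>I. S i)"
    using assms(1,4) fS by (intro card_UN_disjoint[symmetric]) blast+
  also have "\<dots> \<le> card M" using assms by (intro card_mono) blast+
  finally show ?thesis .
qed

text \<open>A set of Latin squares that are constrained only in \<open>R \<times> C\<close>, and not in the cell \<open>(r, c)\<close> of this block. It is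
  closed under every move that respects the block except at \<open>(r, c)\<close>.\<close>
locale free_cell = index_set +
  fixes R C :: "nat set" and r c :: nat and F :: "(nat \<Rightarrow> nat \<Rightarrow> nat) set"
  assumes RU: "R \<subseteq> U" and CU: "C \<subseteq> U" and rR: "r \<in> R" and cC: "c \<in> C"
    and F_latin: "L \<in> F \<Longrightarrow> latin L"
    and F_closed: "L \<in> F \<Longrightarrow> latin M \<Longrightarrow>
      (\<And>i j. i \<in> R \<Longrightarrow> j \<in> C \<Longrightarrow> (i, j) \<noteq> (r, c) \<Longrightarrow> M i j = L i j) \<Longrightarrow> M \<in> F"
begin

lemma elems: "r \<in> U" "c \<in> U" using RU CU rR cC by auto

lemma finite_F: "finite F"
  by (rule finite_subset[OF _ finite_latin]) (auto dest: F_latin)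

text \<open>The switching starts from \<open>switchable e p q\<close>, where the rows \<open>a\<close> and \<open>b\<close> may be rearranged. All its results are
  in \<open>crossed e q p\<close>, and those obtained by turning over an intercalate in \<open>intercalates e q p\<close>.\<close>
definition "crossed e q p = {L \<in> F. L r c = q \<and> L r e = p \<and> (\<exists>a\<in>U - R. L a c = p)}"
definition "intercalates e q p = {L \<in> F. L r c = q \<and> L r e = p \<and> (\<exists>a\<in>U - R. L a c = p \<and> L a e = q)}"
definition "switchable e p q = {L \<in> F. L r c = p \<and> L r e = q \<and> (\<exists>a\<in>U - R. L a c = q) \<and> (\<exists>b\<in>U - R. L b e = p)}"

lemma finite_families: "finite (crossed e q p)" "finite (intercalates e q p)" "finite (switchable e p q)"
  using finite_F by (auto simp: crossed_def intercalates_def switchable_def)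

lemma card_intercalates_le:
  assumes e: "e \<in> U - C" and G: "G + card C + 2 * card R \<le> card U + 1"
  shows "G * card (intercalates e q p) \<le> 17 * card (crossed e q p)"
proof -
  define Tb where "Tb b = {L \<in> F. L r c = q \<and> L r e = p \<and> L b c = p}" for b
  define Yb where "Yb b = {L \<in> Tb b. L b e = q}" for b
  have fin': "finite (U - R)" "finite (Tb b)" "finite (Yb b)" for b using fin finite_F by (auto simp: Tb_def Yb_def)
  have b: "G * card (Yb b) \<le> 17 * card (Tb b)" if bW: "b \<in> U - R" for b
  proof -
    interpret pinned: pinned_family U R C r c b e q p "Tb b"
    proof unfold_locales
      fix L M assume L: "L \<in> Tb b" and M: "latin M" "\<And>i j. i \<in> R \<Longrightarrow> j \<in> C \<Longrightarrow> M i j = L i j"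
        "M r e = L r e" "M b c = L b c"
      have "M \<in> F" by (rule F_closed[of L]) (use L M in \<open>auto simp: Tb_def\<close>)
      then show "M \<in> Tb b" using L M rR cC by (auto simp: Tb_def)
    qed (use RU CU rR cC bW e F_latin in \<open>auto simp: Tb_def\<close>)
    show ?thesis using pinned.card_intercalates[OF G] by (simp add: pinned.intercalates_def Yb_def)
  qed
  have "intercalates e q p = (\<Union>b\<in>U - R. Yb b)" by (auto simp: intercalates_def Yb_def Tb_def)
  then have "G * card (intercalates e q p) \<le> G * (\<Sum>b\<in>U - R. card (Yb b))"
    using card_UN_le[OF fin'(1), of Yb] by simp
  also have "\<dots> \<le> (\<Sum>b\<in>U - R. 17 * card (Tb b))" unfolding sum_distrib_left by (rule sum_mono) (rule b)
  also have "\<dots> = 17 * (\<Sum>b\<in>U - R. card (Tb b))" by (simp add: sum_distrib_left)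
  also have "(\<Sum>b\<in>U - R. card (Tb b)) \<le> card (crossed e q p)"
  proof (rule sum_card_disjoint_le)
    fix b b' L assume "b \<in> U - R" "b' \<in> U - R" "L \<in> Tb b" "L \<in> Tb b'"
    then show "b = b'" using latin_col_eq[OF F_latin elems(2), of L b b'] by (auto simp: Tb_def)
  qed (use fin' finite_F in \<open>auto simp: Tb_def crossed_def\<close>)
  finally show ?thesis by simp
qed

lemma switchable_facts:
  assumes e: "e \<in> U - C" and L: "L \<in> switchable e p q"
  defines "a \<equiv> row_with L c q" and "b \<equiv> row_with L e p"
  shows "L \<in> F" "latin L" "L r c = p" "L r e = q" "a \<in> U" "a \<notin> R" "b \<in> U" "b \<notin> R" "L a c = q" "L b e = p" "p \<noteq> q"
    "e \<in> U" "e \<noteq> c" "p \<in> U" "q \<in> U" "a \<noteq> r" "b \<noteq> r"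
proof -
  show l: "L \<in> F" "latin L" "L r c = p" "L r e = q" using L F_latin by (auto simp: switchable_def)
  show eU: "e \<in> U" "e \<noteq> c" using e cC by auto
  obtain a' b' where ab: "a' \<in> U - R" "L a' c = q" "b' \<in> U - R" "L b' e = p" using L by (auto simp: switchable_def)
  have "a = a'" "b = b'"
    using row_with_eqI[OF l(2) elems(2), of a' q] row_with_eqI[OF l(2) eU(1), of b' p] ab by (auto simp: a_def b_def)
  then show "a \<in> U" "a \<notin> R" "b \<in> U" "b \<notin> R" "L a c = q" "L b e = p" using ab by auto
  then show "a \<noteq> r" "b \<noteq> r" using rR by auto
  show "p \<noteq> q" using latin_row_eq[OF l(2) elems(1) elems(2) eU(1)] eU(2) l(3,4) by auto
  show "p \<in> U" "q \<in> U" using latin_mem[OF l(2) elems] latin_mem[OF l(2) elems(1) eU(1)] l(3,4) by auto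
qed

lemma row_move_same: "row_move a a k L = L"
  by (auto simp: row_move_def' fun_eq_iff)

text \<open>The set \<open>XD\<close> is where an intercalate can be produced, which includes the case \<open>a = b\<close>; the row \<open>b\<close> has to be
  remembered. Elsewhere the corner move applies with the single row \<open>r\<close> as the bridge between the columns
  \<open>c\<close> and \<open>e\<close>, and its result is again switchable.\<close>
lemma switch_bound:
  assumes e: "e \<in> U - C"
  shows "card (switchable e p q) \<le> card (switchable e q p) + card U * card (intercalates e q p)"
proof -
  define XD where "XD = {L \<in> switchable e p q. row_with L c q = row_with L e p \<or>
      (\<exists>Z. closed_set (L (row_with L c q)) (L (row_with L e p)) Z \<and> e \<in> Z \<and> c \<notin> Z)}"
  define f where "f L = (row_swap r (row_with L c q) {c, e} (row_move (row_with L c q) (row_with L e p) e L), row_with L e p)" for L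
  define g where "g = (\<lambda>(M, b). row_move (row_with M c p) b e (row_swap r (row_with M c p) {c, e} M))"
  have "card XD \<le> card (intercalates e q p \<times> U)"
  proof (rule card_inj_on_le[of f])
    have key: "f L \<in> intercalates e q p \<times> U \<and> g (f L) = L" if LD: "L \<in> XD" for L
    proof -
      define a b where "a = row_with L c q" and "b = row_with L e p"
      have LX: "L \<in> switchable e p q" using LD by (simp add: XD_def)
      note f = switchable_facts[OF e LX, folded a_def b_def]
      define M where "M = row_move a b e L"
      have M: "latin M" "M a c = q" "M a e = p" "row_move a b e M = L" "i \<noteq> a \<Longrightarrow> i \<noteq> b \<Longrightarrow> M i = L i" for i
      proof -
        have "latin M \<and> M a c = q \<and> M a e = p \<and> row_move a b e M = L"
        proof (cases "a = b")
          case True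
          then show ?thesis using f by (simp add: M_def row_move_same)
        next
          case False
          then obtain Z where Z: "closed_set (L a) (L b) Z" "e \<in> Z" "c \<notin> Z"
            using LD by (auto simp: XD_def a_def b_def)
          have cc: "c \<notin> component (L a) (L b) e" using component_least[OF Z(1,2)] Z(3) by blast
          note rm = row_move[OF f(2,5,7) False f(12)]
          show ?thesis
            using rm row_move_outside[OF cc] row_move_inside(1)[where L = L, OF component_self] f by (simp add: M_def)
        qed
        then show "latin M" "M a c = q" "M a e = p" "row_move a b e M = L" by auto
        show "i \<noteq> a \<Longrightarrow> i \<noteq> b \<Longrightarrow> M i = L i" by (simp add: M_def row_move_other)
      qed
      have Mr: "M r c = p" "M r e = q" using M(5)[of r] f by auto
      define N where "N = row_swap r a {c, e} M"
      have "closed_set (M r) (M a) {c, e}" using Mr M f elems by (auto simp: closed_set_def)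
      then have N: "latin N" unfolding N_def by (rule row_swap_latin[OF M(1) elems(1) f(5)])
      have Nv: "N r c = q" "N r e = p" "N a c = p" "N a e = q" using M f(16) Mr by (auto simp: N_def row_swap_def)
      have "N \<in> F"
      proof (rule F_closed[OF f(1) N])
        fix i j assume ij: "i \<in> R" "j \<in> C" "(i, j) \<noteq> (r, c)"
        then have i: "i \<noteq> a" "i \<noteq> b" "j \<noteq> e" using f e by auto
        then have "N i j = M i j" using ij by (auto simp: N_def row_swap_def)
        then show "N i j = L i j" using M(5)[OF i(1,2)] by simp
      qed
      then have "N \<in> intercalates e q p" using Nv f by (auto simp: intercalates_def)
      moreover have "f L = (N, b)" by (simp add: f_def N_def M_def a_def b_def)
      moreover have "row_with N c p = a" by (rule row_with_eqI[OF N elems(2) f(5) Nv(3)])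
      then have "g (N, b) = L" unfolding g_def using row_swap_row_swap[OF f(16)[symmetric]] M(4) by (simp add: N_def)
      ultimately show ?thesis using f(7) by simp
    qed
    show "inj_on f XD" using key by (intro inj_on_inverseI[of _ g]) blast
    show "f ` XD \<subseteq> intercalates e q p \<times> U" using key by blast
  qed (use fin finite_families in simp)
  moreover have "card (switchable e p q - XD) \<le> card (switchable e q p)"
  proof (rule card_inj_on_le[of "\<lambda>L. corner_move (row_with L c q) (row_with L e p) c e L"])
    have key: "corner_move (row_with L c q) (row_with L e p) c e L \<in> switchable e q p \<and>
       (\<lambda>M. corner_move (row_with M c p) (row_with M e q) c e M) (corner_move (row_with L c q) (row_with L e p) c e L) = L"
      if LD: "L \<in> switchable e p q - XD" for L
    proof -
      define a b where "a = row_with L c q" and "b = row_with L e p"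
      have LX: "L \<in> switchable e p q" using LD by simp
      note f = switchable_facts[OF e LX, folded a_def b_def]
      have ab: "a \<noteq> b" using LD by (auto simp: XD_def a_def b_def)
      have col: "bridge (col L c) (col L e) (L a c) (L b e) {r}"
        using f elems by (auto simp: bridge_def)
      have "\<exists>K. bridge (L a) (L b) (L a c) (L b e) K"
        by (rule separating_or_bridge[OF f(2,5,7) elems(2) f(12)]) (use f LD in \<open>auto simp: XD_def a_def b_def\<close>)
      then have cor: "cornered a b c e L" using f ab elems col by (auto simp: cornered_def)
      define M where "M = corner_move a b c e L"
      define H where "H = least_bridge (col L c) (col L e) (L a c) (L b e)"
      note cm = corner_move[OF cor, folded M_def H_def]
      have "H \<subseteq> {r}" using col by (auto simp: H_def least_bridge_def)
      moreover have "H \<noteq> {}" using cm(2) f by (auto simp: bridge_def)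
      ultimately have H: "H = {r}" by auto
      have Mdef: "M = corner_swap (least_bridge (L a) (L b) (L a c) (L b e)) {r} a b c e L"
        unfolding M_def corner_move_def H[unfolded H_def] ..
      have Mv: "M r c = q" "M r e = p" "M a c = p" "M b e = q" 
        using f ab by (auto simp: Mdef corner_swap_def)
      have "M \<in> F"
      proof (rule F_closed[OF f(1) cm(9)])
        fix i j assume ij: "i \<in> R" "j \<in> C" "(i, j) \<noteq> (r, c)"
        then have "i \<noteq> a" "i \<noteq> b" "j \<noteq> e" using f e by auto
        then show "M i j = L i j" using ij by (auto simp: Mdef corner_swap_def)
      qed
      then have "M \<in> switchable e q p" using Mv f by (auto simp: switchable_def)
      moreover have "row_with M c p = a" "row_with M e q = b"
        using row_with_eqI[OF cm(9) elems(2) f(5) Mv(3)] row_with_eqI[OF cm(9) f(12,7) Mv(4)] by auto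
      ultimately show ?thesis using cm(10) by (simp add: M_def a_def b_def)
    qed
    show "inj_on (\<lambda>L. corner_move (row_with L c q) (row_with L e p) c e L) (switchable e p q - XD)"
      by (rule inj_on_inverseI[where g = "\<lambda>M. corner_move (row_with M c p) (row_with M e q) c e M"])
        (use key in blast)
    show "(\<lambda>L. corner_move (row_with L c q) (row_with L e p) c e L) ` (switchable e p q - XD) \<subseteq> switchable e q p" using key by blast
  qed (rule finite_families)
  moreover have "card (switchable e p q) = card XD + card (switchable e p q - XD)"
  proof -
    have sub: "XD \<subseteq> switchable e p q" by (auto simp: XD_def)
    show ?thesis
      using card_mono[OF finite_families(3) sub] card_Diff_subset[OF finite_subset[OF sub finite_families(3)] sub] by simp
  qed
  ultimately show ?thesis by (simp add: card_cartesian_product mult.commute)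
qed

lemma switch_bound_crossed:
  assumes e: "e \<in> U - C" and G: "G + card C + 2 * card R \<le> card U + 1"
  shows "G * card (switchable e p q) \<le> (G + 17 * card U) * card (crossed e q p)"
proof -
  have "switchable e q p \<subseteq> crossed e q p" by (auto simp: switchable_def crossed_def)
  then have XT: "card (switchable e q p) \<le> card (crossed e q p)" using finite_families by (intro card_mono)
  have "G * card (switchable e p q) \<le> G * card (switchable e q p) + card U * (G * card (intercalates e q p))"
    using mult_le_mono2[OF switch_bound[OF e, of p q], of G] by (simp add: algebra_simps)
  also have "\<dots> \<le> G * card (crossed e q p) + card U * (17 * card (crossed e q p))"
    using XT card_intercalates_le[OF e G, of q p] by (intro add_mono mult_le_mono2)
  finally show ?thesis by (simp add: algebra_simps)
qed

text \<open>A column is excluded if one of the two rows to be rearranged is in \<open>R\<close>. As these rows differ from \<open>r\<close>, each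
  condition excludes at most \<open>card R - 1\<close> columns.\<close>
lemma many_switch_columns:
  assumes L: "L \<in> F" "L r c = s" and G: "G + card C + 2 * card R \<le> card U + 1"
  shows "G \<le> card {e \<in> U - C. L \<in> switchable e s (L r e)}"
proof -
  have l: "latin L" using F_latin L by simp
  have sU: "s \<in> U" using latin_mem[OF l elems] L by simp
  define V where "V = U - C"
  define B1 where "B1 = {e \<in> V. row_with L c (L r e) \<in> R}"
  define B2 where "B2 = {e \<in> V. row_with L e s \<in> R}"
  have finV: "finite V" "finite C" "finite R" using fin RU CU by (auto simp: V_def intro: finite_subset)
  have cV: "card V + card C = card U"
    using card_Diff_subset[OF finV(2) CU] card_mono[OF fin CU] by (simp add: V_def)
  have R0: "card (R - {r}) + 1 = card R" using card_Suc_Diff1[OF finV(3) rR] by simp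
  have b1: "card B1 \<le> card (R - {r})"
  proof (rule card_inj_on_le[of "\<lambda>k. row_with L c (L r k)"])
    have ent: "L (row_with L c (L r k)) c = L r k" if "k \<in> V" for k
      using row_with(2)[OF l elems(2) latin_mem[OF l elems(1)]] that unfolding V_def by blast
    show "inj_on (\<lambda>k. row_with L c (L r k)) B1"
    proof (rule inj_onI)
      fix k k' assume k: "k \<in> B1" "k' \<in> B1" "row_with L c (L r k) = row_with L c (L r k')"
      have kV: "k \<in> V" "k' \<in> V" using k by (auto simp: B1_def)
      have "L r k = L (row_with L c (L r k)) c" using ent[OF kV(1)] by (rule sym)
      also have "\<dots> = L (row_with L c (L r k')) c" by (simp only: k(3))
      also have "\<dots> = L r k'" by (rule ent[OF kV(2)])
      finally show "k = k'" using latin_row_eq[OF l elems(1), of k k'] kV by (simp add: V_def)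
    qed
    show "(\<lambda>k. row_with L c (L r k)) ` B1 \<subseteq> R - {r}"
    proof clarify
      fix k assume k: "k \<in> B1"
      have "row_with L c (L r k) \<noteq> r"
      proof
        assume "row_with L c (L r k) = r"
        then have "L r k = L r c" using ent[of k] k by (auto simp: B1_def)
        then show False using latin_row_eq[OF l elems(1) _ elems(2), of k] k cC by (auto simp: B1_def V_def)
      qed
      then show "row_with L c (L r k) \<in> R - {r}" using k by (simp add: B1_def)
    qed
  qed (use finV in simp)
  have b2: "card B2 \<le> card (R - {r})"
  proof (rule card_inj_on_le[of "\<lambda>k. row_with L k s"])
    have ent: "L (row_with L k s) k = s" "row_with L k s \<in> U" if "k \<in> V" for k
      using row_with[OF l _ sU] that by (auto simp: V_def)
    show "inj_on (\<lambda>k. row_with L k s) B2"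
    proof (rule inj_onI)
      fix k k' assume k: "k \<in> B2" "k' \<in> B2" "row_with L k s = row_with L k' s"
      have kV: "k \<in> V" "k' \<in> V" using k by (auto simp: B2_def)
      have "L (row_with L k s) k = L (row_with L k' s) k'" using ent(1)[OF kV(1)] ent(1)[OF kV(2)] by (rule trans[OF _ sym])
      also have "\<dots> = L (row_with L k s) k'" by (simp only: k(3))
      finally show "k = k'" using latin_row_eq[OF l ent(2)[OF kV(1)], of k k'] kV by (simp add: V_def)
    qed
    show "(\<lambda>k. row_with L k s) ` B2 \<subseteq> R - {r}"
    proof clarify
      fix k assume k: "k \<in> B2"
      have "row_with L k s \<noteq> r"
      proof
        assume "row_with L k s = r"
        then have "L r k = s" using ent(1)[of k] k by (auto simp: B2_def)
        then show False using latin_row_eq[OF l elems(1) _ elems(2), of k] k cC L by (auto simp: B2_def V_def)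
      qed
      then show "row_with L k s \<in> R - {r}" using k by (simp add: B2_def)
    qed
  qed (use finV in simp)
  have "V \<subseteq> {e \<in> V. L \<in> switchable e s (L r e)} \<union> B1 \<union> B2"
  proof
    fix k assume k: "k \<in> V"
    then have kU: "k \<in> U" by (simp add: V_def)
    note a = row_with[OF l elems(2) latin_mem[OF l elems(1) kU]] and b = row_with[OF l kU sU]
    show "k \<in> {e \<in> V. L \<in> switchable e s (L r e)} \<union> B1 \<union> B2"
    proof (cases "row_with L c (L r k) \<in> R \<or> row_with L k s \<in> R")
      case True
      then show ?thesis using k by (auto simp: B1_def B2_def)
    next
      case False
      then have "L \<in> switchable k s (L r k)" using L a b unfolding switchable_def by blast
      then show ?thesis using k by simp
    qed
  qed
  then have "card V \<le> card ({e \<in> V. L \<in> switchable e s (L r e)} \<union> B1 \<union> B2)"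
    using finV by (intro card_mono) (auto simp: B1_def B2_def)
  also have "\<dots> \<le> card {e \<in> V. L \<in> switchable e s (L r e)} + card B1 + card B2"
    by (meson card_Un_le le_trans add_le_mono1)
  finally show ?thesis using cV b1 b2 R0 G by (simp add: V_def)
qed

text \<open>After switching \<open>s\<close> from \<open>(r, c)\<close> to \<open>(r, e)\<close> the column \<open>e\<close> and the new symbol of \<open>(r, c)\<close> are determined by the result, so
  no factor \<open>n\<close> is lost, and \<open>s\<close> occurs outside \<open>R\<close> in column \<open>c\<close>.\<close>
lemma cell_upper:
  assumes G: "G + card C + 2 * card R \<le> card U + 1"
  shows "G * G * card {L \<in> F. L r c = s} \<le>
    (G + 17 * card U) * card {L \<in> F. (\<exists>a\<in>U - R. L a c = s) \<and> (\<exists>e\<in>U - C. L r e = s)}"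
proof -
  define M where "M = {L \<in> F. L r c = s}"
  define I where "I = (U - C) \<times> U"
  have finI: "finite I" and finM: "finite M" using fin finite_F by (auto simp: I_def M_def)
  have "G * card M = (\<Sum>L\<in>M. G)" by simp
  also have "\<dots> \<le> (\<Sum>L\<in>M. card {e \<in> U - C. L \<in> switchable e s (L r e)})"
    using many_switch_columns[OF _ _ G] by (intro sum_mono) (simp add: M_def)
  also have "\<dots> = card (SIGMA L:M. {e \<in> U - C. L \<in> switchable e s (L r e)})"
    using fin finM by simp
  also have "\<dots> \<le> card (SIGMA v:I. switchable (fst v) s (snd v))"
  proof (rule card_inj_on_le[of "\<lambda>(L, e). ((e, L r e), L)"])
    show "(\<lambda>(L, e). ((e, L r e), L)) ` (SIGMA L:M. {e \<in> U - C. L \<in> switchable e s (L r e)}) \<subseteq> (SIGMA v:I. switchable (fst v) s (snd v))"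
      using latin_mem[OF F_latin elems(1)] by (auto simp: M_def I_def)
  qed (use finI finite_families in \<open>auto simp: inj_on_def\<close>)
  also have "\<dots> = (\<Sum>v\<in>I. card (switchable (fst v) s (snd v)))" using finI finite_families by simp
  finally have "G * (G * card M) \<le> (\<Sum>v\<in>I. G * card (switchable (fst v) s (snd v)))"
    unfolding sum_distrib_left[symmetric] by simp
  also have "\<dots> \<le> (\<Sum>v\<in>I. (G + 17 * card U) * card (crossed (fst v) (snd v) s))"
    by (intro sum_mono switch_bound_crossed[OF _ G]) (auto simp: I_def)
  also have "\<dots> = (G + 17 * card U) * (\<Sum>v\<in>I. card (crossed (fst v) (snd v) s))"
    by (simp only: sum_distrib_left)
  also have "(\<Sum>v\<in>I. card (crossed (fst v) (snd v) s)) \<le>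
      card {L \<in> F. (\<exists>a\<in>U - R. L a c = s) \<and> (\<exists>e\<in>U - C. L r e = s)}"
  proof (rule sum_card_disjoint_le)
    fix v v' L assume v: "v \<in> I" "v' \<in> I" "L \<in> crossed (fst v) (snd v) s" "L \<in> crossed (fst v') (snd v') s"
    then have "fst v = fst v'" using latin_row_eq[OF F_latin elems(1), of L "fst v" "fst v'"]
      by (auto simp: crossed_def I_def)
    then show "v = v'" using v by (auto simp: crossed_def prod_eq_iff)
  qed (use finI finite_F in \<open>auto simp: crossed_def I_def\<close>)
  finally show ?thesis by (simp add: M_def mult.assoc)
qed

text \<open>In the opposite direction the column \<open>e\<close> is lost: once \<open>s\<close> is in \<open>(r, c)\<close>, it could have come from any column.\<close>
lemma cell_lower:
  assumes G: "G + card C + 2 * card R \<le> card U + 1"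
  shows "G * card {L \<in> F. (\<exists>a\<in>U - R. L a c = s) \<and> (\<exists>e\<in>U - C. L r e = s \<and> (\<exists>b\<in>U - R. L b e = L r c))} \<le>
    (G + 17 * card U) * card U * card {L \<in> F. L r c = s}"
proof -
  define M where "M = {L \<in> F. L r c = s}"
  define I where "I = (U - C) \<times> U"
  have finI: "finite I" and finM: "finite M" using fin finite_F by (auto simp: I_def M_def)
  have "{L \<in> F. (\<exists>a\<in>U - R. L a c = s) \<and> (\<exists>e\<in>U - C. L r e = s \<and> (\<exists>b\<in>U - R. L b e = L r c))} \<subseteq>
      (\<Union>v\<in>I. switchable (fst v) (snd v) s)"
    using latin_mem[OF F_latin elems] by (fastforce simp: switchable_def I_def)
  then have "card {L \<in> F. (\<exists>a\<in>U - R. L a c = s) \<and> (\<exists>e\<in>U - C. L r e = s \<and> (\<exists>b\<in>U - R. L b e = L r c))} \<le>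
      card (\<Union>v\<in>I. switchable (fst v) (snd v) s)"
    using finI finite_families by (intro card_mono) auto
  also have "\<dots> \<le> (\<Sum>v\<in>I. card (switchable (fst v) (snd v) s))" by (rule card_UN_le[OF finI])
  finally have "G * card {L \<in> F. (\<exists>a\<in>U - R. L a c = s) \<and> (\<exists>e\<in>U - C. L r e = s \<and> (\<exists>b\<in>U - R. L b e = L r c))} \<le>
      (\<Sum>v\<in>I. G * card (switchable (fst v) (snd v) s))"
    unfolding sum_distrib_left[symmetric] by simp
  also have "\<dots> \<le> (\<Sum>v\<in>I. (G + 17 * card U) * card (crossed (fst v) s (snd v)))"
    by (intro sum_mono switch_bound_crossed[OF _ G]) (auto simp: I_def)
  also have "\<dots> = (G + 17 * card U) * (\<Sum>e\<in>U - C. \<Sum>p\<in>U. card (crossed e s p))"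
    by (simp only: sum_distrib_left I_def sum.cartesian_product) (simp add: case_prod_beta)
  also have "(\<Sum>e\<in>U - C. \<Sum>p\<in>U. card (crossed e s p)) \<le> (\<Sum>e\<in>U - C. card M)"
    by (intro sum_mono sum_card_disjoint_le) (auto simp: fin finite_F crossed_def M_def)
  also have "\<dots> \<le> card U * card M" using card_mono[OF fin, of "U - C"] by simp
  finally show ?thesis by (simp add: M_def mult.assoc)
qed

end

section \<open>Adding one entry to a partial Latin square\<close>

context index_set begin

definition completions :: "(nat \<times> nat \<times> nat) set \<Rightarrow> (nat \<Rightarrow> nat \<Rightarrow> nat) set" where
  "completions Q = {L. latin L \<and> (\<forall>(i, j, k)\<in>Q. L i j = k)}"

lemma finite_completions: "finite (completions Q)"
  by (rule finite_subset[OF _ finite_latin]) (auto simp: completions_def)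

end

text \<open>An entry \<open>(r, c, s)\<close> that can be added to the partial Latin square \<open>Q\<close> without a conflict. The rows and columns of \<open>Q\<close> and of
  the new entry are in \<open>R\<close> and \<open>C\<close>, which may be larger.\<close>
locale open_entry = index_set +
  fixes R C :: "nat set" and Q :: "(nat \<times> nat \<times> nat) set" and r c s G :: nat
  assumes RU: "R \<subseteq> U" and CU: "C \<subseteq> U" and rR: "r \<in> R" and cC: "c \<in> C" and sU: "s \<in> U"
    and Q_block: "(i, j, k) \<in> Q \<Longrightarrow> i \<in> R \<and> j \<in> C"
    and cell_free: "(r, c, k) \<notin> Q" and row_free: "(r, j, s) \<notin> Q" and col_free: "(i, c, s) \<notin> Q"
    and G: "G + card C + 2 * card R \<le> card U"
begin

lemma elems: "r \<in> U" "c \<in> U" using RU CU rR cC by auto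

definition "F = completions Q"
definition "E = {L \<in> F. L r c = s}"
text \<open>The squares in which \<open>s\<close> can be switched into \<open>(r, c)\<close> are those in \<open>N3\<close>. They are reached from \<open>F\<close> by three
  successive restrictions: on the row of \<open>s\<close> in column \<open>c\<close>, on the column of \<open>s\<close> in row \<open>r\<close>, and on the row
  that holds the displaced symbol in that column.\<close>
definition "N1 = {L \<in> F. \<exists>a\<in>U - R. L a c = s}"
definition "N2 = {L \<in> N1. \<exists>e\<in>U - C. L r e = s}"
definition "N3 = {L \<in> F. (\<exists>a\<in>U - R. L a c = s) \<and> (\<exists>e\<in>U - C. L r e = s \<and> (\<exists>b\<in>U - R. L b e = L r c))}"
definition "cost = G + 17 * card U"

lemma F_latin: "L \<in> F \<Longrightarrow> latin L"
  by (simp add: F_def completions_def)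

lemma F_entry: "L \<in> F \<Longrightarrow> (i, j, k) \<in> Q \<Longrightarrow> L i j = k"
  by (auto simp: F_def completions_def)

lemma finite_sets: "finite F" "finite E" "finite N1" "finite N2" "finite N3"
  using finite_completions[of Q] by (auto simp: F_def E_def N1_def N2_def N3_def)

lemma finite_RC: "finite R" "finite C" using fin RU CU by (auto intro: finite_subset)

lemma F_closed:
  assumes "L \<in> F" "latin M" "\<And>i j k. (i, j, k) \<in> Q \<Longrightarrow> M i j = L i j"
  shows "M \<in> F"
  using assms by (auto simp: F_def completions_def)

lemma N1_iff: "L \<in> N1 \<longleftrightarrow> L \<in> F \<and> (\<forall>i\<in>R. L i c \<noteq> s)"
proof
  assume "L \<in> N1"
  then obtain a where a: "L \<in> F" "a \<in> U" "a \<notin> R" "L a c = s" by (auto simp: N1_def)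
  have "L i c \<noteq> s" if "i \<in> R" for i
    using latin_col_eq[OF F_latin[OF a(1)] elems(2), of i a] that a RU by auto
  then show "L \<in> F \<and> (\<forall>i\<in>R. L i c \<noteq> s)" using a by blast
next
  assume L: "L \<in> F \<and> (\<forall>i\<in>R. L i c \<noteq> s)"
  note w = row_with[OF F_latin elems(2) sU, of L]
  have "row_with L c s \<notin> R" using w(2) L by blast
  then show "L \<in> N1" using w L by (auto simp: N1_def)
qed

lemma cell_family: "free_cell U R C r c F"
proof unfold_locales
  fix L M assume LM: "L \<in> F" "latin M" "\<And>i j. i \<in> R \<Longrightarrow> j \<in> C \<Longrightarrow> (i, j) \<noteq> (r, c) \<Longrightarrow> M i j = L i j"
  show "M \<in> F"
  proof (rule F_closed[OF LM(1,2)])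
    fix i j k assume "(i, j, k) \<in> Q"
    then show "M i j = L i j" using Q_block cell_free by (intro LM(3)) auto
  qed
qed (use RU CU rR cC F_latin in auto)

lemma cell_E: "G * G * card E \<le> cost * card F"
proof -
  interpret cell: free_cell U R C r c F by (rule cell_family)
  have "G * G * card E \<le> cost * card {L \<in> F. (\<exists>a\<in>U - R. L a c = s) \<and> (\<exists>e\<in>U - C. L r e = s)}"
    unfolding E_def cost_def by (rule cell.cell_upper) (use G in simp)
  also have "\<dots> \<le> cost * card F" using finite_sets by (intro mult_le_mono2 card_mono) auto
  finally show ?thesis .
qed

lemma card_N3: "G * card N3 \<le> cost * card U * card E"
proof -
  interpret cell: free_cell U R C r c F by (rule cell_family)
  show ?thesis unfolding N3_def E_def cost_def by (rule cell.cell_lower) (use G in simp)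
qed

text \<open>A cell \<open>(i, c)\<close> with \<open>i \<in> R\<close> that contains \<open>s\<close> is not a cell of \<open>Q\<close>, by \<open>col_free\<close>. So \<open>s\<close> can be switched
  out of it, and then the row of \<open>s\<close> in column \<open>c\<close> is outside \<open>R\<close>.\<close>
lemma card_F: "G * G * card F \<le> G * G * card E + (G * G + card R * cost) * card N1"
proof -
  define B where "B i = {L \<in> F. L i c = s}" for i
  have finB: "finite (B i)" for i using finite_sets by (simp add: B_def)
  have bound: "G * G * card (B i) \<le> cost * card N1" if i: "i \<in> R - {r}" for i
  proof (cases "\<exists>k. (i, c, k) \<in> Q")
    case True
    then obtain k where k: "(i, c, k) \<in> Q" by blast
    then have "k \<noteq> s" using col_free by blast
    then have "B i = {}" using F_entry[OF _ k] by (auto simp: B_def)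
    then show ?thesis by simp
  next
    case False
    interpret cell: free_cell U R C i c F
    proof unfold_locales
      fix L M assume LM: "L \<in> F" "latin M" "\<And>i' j. i' \<in> R \<Longrightarrow> j \<in> C \<Longrightarrow> (i', j) \<noteq> (i, c) \<Longrightarrow> M i' j = L i' j"
      show "M \<in> F"
      proof (rule F_closed[OF LM(1,2)])
        fix i' j k assume "(i', j, k) \<in> Q"
        then show "M i' j = L i' j" using Q_block False by (intro LM(3)) auto
      qed
    qed (use RU CU i cC F_latin in auto)
    have "G * G * card (B i) \<le> cost * card {L \<in> F. (\<exists>a\<in>U - R. L a c = s) \<and> (\<exists>e\<in>U - C. L i e = s)}"
      unfolding B_def cost_def by (rule cell.cell_upper) (use G in simp)
    also have "\<dots> \<le> cost * card N1"
      using finite_sets by (intro mult_le_mono2 card_mono) (auto simp: N1_def)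
    finally show ?thesis .
  qed
  have "F \<subseteq> E \<union> N1 \<union> (\<Union>i\<in>R - {r}. B i)"
    by (auto simp: N1_iff E_def B_def)
  then have "card F \<le> card (E \<union> N1 \<union> (\<Union>i\<in>R - {r}. B i))"
    using finite_sets finite_RC finB by (intro card_mono) auto
  also have "\<dots> \<le> card E + card N1 + (\<Sum>i\<in>R - {r}. card (B i))"
    by (intro order.trans[OF card_Un_le] add_mono card_Un_le card_UN_le) (simp add: finite_RC)
  finally have "card F \<le> card E + card N1 + (\<Sum>i\<in>R - {r}. card (B i))" .
  from mult_le_mono2[OF this, of "G * G"]
  have "G * G * card F \<le> G * G * (card E + card N1) + (\<Sum>i\<in>R - {r}. G * G * card (B i))"
    by (simp add: distrib_left sum_distrib_left)
  also have "(\<Sum>i\<in>R - {r}. G * G * card (B i)) \<le> (\<Sum>i\<in>R - {r}. cost * card N1)"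
    by (rule sum_mono) (rule bound)
  also have "\<dots> \<le> card R * (cost * card N1)" using card_mono[OF finite_RC(1), of "R - {r}"] by simp
  finally show ?thesis by (simp add: algebra_simps)
qed

text \<open>Now \<open>s\<close> is switched out of the cells \<open>(r, j)\<close>. Column \<open>c\<close> is not affected within \<open>R\<close>, so the first
  condition persists.\<close>
lemma card_N1: "G * G * card N1 \<le> (G * G + card C * cost) * card N2"
proof -
  define B where "B j = {L \<in> N1. L r j = s}" for j
  have finB: "finite (B i)" for i using finite_sets by (simp add: B_def)
  have bound: "G * G * card (B j) \<le> cost * card N2" if j: "j \<in> C" for j
  proof (cases "j = c \<or> (\<exists>k. (r, j, k) \<in> Q)")
    case True
    have "B j = {}"
    proof (cases "j = c")
      case True
      then show ?thesis using rR by (auto simp: B_def N1_iff)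
    next
      case False
      then obtain k where k: "(r, j, k) \<in> Q" using True by blast
      then have "k \<noteq> s" using row_free by blast
      then show ?thesis using F_entry[OF _ k] by (auto simp: B_def N1_def)
    qed
    then show ?thesis by simp
  next
    case False
    interpret cell: free_cell U R C r j N1
    proof unfold_locales
      fix L M assume LM: "L \<in> N1" "latin M" "\<And>i j'. i \<in> R \<Longrightarrow> j' \<in> C \<Longrightarrow> (i, j') \<noteq> (r, j) \<Longrightarrow> M i j' = L i j'"
      have "M \<in> F"
      proof (rule F_closed[OF _ LM(2)])
        show "L \<in> F" using LM by (simp add: N1_def)
        fix i j' k assume "(i, j', k) \<in> Q"
        then show "M i j' = L i j'" using Q_block False by (intro LM(3)) auto
      qed
      moreover have "M i c \<noteq> s" if "i \<in> R" for i
        using LM(3)[OF that cC] LM(1) False that by (auto simp: N1_iff)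
      ultimately show "M \<in> N1" by (simp add: N1_iff)
    qed (use RU CU j rR F_latin in \<open>auto simp: N1_def\<close>)
    have "G * G * card (B j) \<le> cost * card {L \<in> N1. (\<exists>a\<in>U - R. L a j = s) \<and> (\<exists>e\<in>U - C. L r e = s)}"
      unfolding B_def cost_def by (rule cell.cell_upper) (use G in simp)
    also have "\<dots> \<le> cost * card N2"
      using finite_sets by (intro mult_le_mono2 card_mono) (auto simp: N2_def)
    finally show ?thesis .
  qed
  have "N1 \<subseteq> N2 \<union> (\<Union>j\<in>C. B j)"
  proof
    fix L assume L: "L \<in> N1"
    then have l: "latin L" using F_latin by (simp add: N1_def)
    note w = col_with[OF l elems(1) sU]
    show "L \<in> N2 \<union> (\<Union>j\<in>C. B j)" using w L by (cases "col_with L r s \<in> C") (auto simp: N2_def B_def)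
  qed
  then have "card N1 \<le> card (N2 \<union> (\<Union>j\<in>C. B j))"
    using finite_sets finite_RC finB by (intro card_mono) auto
  also have "\<dots> \<le> card N2 + (\<Sum>j\<in>C. card (B j))"
    by (intro order.trans[OF card_Un_le] add_mono order.refl card_UN_le) (simp add: finite_RC)
  finally have "card N1 \<le> card N2 + (\<Sum>j\<in>C. card (B j))" .
  from mult_le_mono2[OF this, of "G * G"]
  have "G * G * card N1 \<le> G * G * card N2 + (\<Sum>j\<in>C. G * G * card (B j))"
    by (simp add: distrib_left sum_distrib_left)
  also have "(\<Sum>j\<in>C. G * G * card (B j)) \<le> (\<Sum>j\<in>C. cost * card N2)"
    by (rule sum_mono) (rule bound)
  finally show ?thesis by (simp add: algebra_simps)
qed

text \<open>With \<open>s\<close> in \<open>(r, e)\<close> and \<open>w\<close> in \<open>(r, c)\<close>, the symbol \<open>w\<close> is switched out of the cells \<open>(i, e)\<close>. For this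
  the column \<open>e\<close> is added to \<open>C\<close>, which keeps \<open>(r, e)\<close> fixed. It costs one column of the slack \<open>G\<close>, and is the reason why \<open>open_entry\<close> asks for
  one more than \<open>cell_upper\<close>.\<close>
lemma card_N2: "G * G * card N2 \<le> (G * G + card R * cost) * card N3"
proof -
  define H where "H v = {L \<in> N1. L r (fst v) = s \<and> L r c = snd v}" for v
  define D where "D v = {L \<in> H v. \<exists>b\<in>U - R. L b (fst v) = snd v}" for v
  define B where "B i v = {L \<in> H v. L i (fst v) = snd v}" for i v
  define I where "I = (U - C) \<times> U"
  have finI: "finite I" using fin by (simp add: I_def)
  have finB: "finite (B i v)" "finite (D v)" for i v using finite_sets by (auto simp: B_def H_def D_def)
  have bound: "G * G * card (B i v) \<le> cost * card (D v)" if i: "i \<in> R - {r}" and v: "v \<in> I" for i v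
  proof -
    define e w where "e = fst v" and "w = snd v"
    have ew: "e \<in> U" "e \<notin> C" using v by (auto simp: I_def e_def)
    interpret cell: free_cell U R "insert e C" i e "H v"
    proof unfold_locales
      fix L M assume LM: "L \<in> H v" "latin M" "\<And>i' j. i' \<in> R \<Longrightarrow> j \<in> insert e C \<Longrightarrow> (i', j) \<noteq> (i, e) \<Longrightarrow> M i' j = L i' j"
      have "M \<in> F"
      proof (rule F_closed[OF _ LM(2)])
        show "L \<in> F" using LM by (simp add: H_def N1_def)
        fix i' j k assume "(i', j, k) \<in> Q"
        then show "M i' j = L i' j" using Q_block ew by (intro LM(3)) auto
      qed
      moreover have "M i' c \<noteq> s" if "i' \<in> R" for i'
      proof -
        have "M i' c = L i' c" by (rule LM(3)) (use that ew cC in auto)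
        moreover have "L i' c \<noteq> s" using LM(1) that by (simp add: H_def N1_iff)
        ultimately show ?thesis by simp
      qed
      moreover have "M r e = L r e" "M r c = L r c" using LM(3)[OF rR, of e] LM(3)[OF rR, of c] i cC by auto
      ultimately show "M \<in> H v" using LM(1) by (auto simp: H_def N1_iff e_def)
    qed (use RU CU i ew F_latin in \<open>auto simp: H_def N1_def\<close>)
    have c: "card (insert e C) = card C + 1" using ew finite_RC by simp
    have "G * G * card (B i v) \<le> cost * card {L \<in> H v. (\<exists>a\<in>U - R. L a e = w) \<and> (\<exists>j\<in>U - insert e C. L i j = w)}"
      unfolding B_def cost_def e_def[symmetric] w_def[symmetric] by (rule cell.cell_upper) (use G c in simp)
    also have "\<dots> \<le> cost * card (D v)"
      using finB by (intro mult_le_mono2 card_mono) (auto simp: D_def e_def w_def)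
    finally show ?thesis .
  qed
  \<comment> \<open>a square in \<open>N3\<close> determines the column of \<open>s\<close> in row \<open>r\<close> and the symbol of \<open>(r, c)\<close>\<close>
  have D: "(\<Sum>v\<in>I. card (D v)) \<le> card N3"
  proof (rule sum_card_disjoint_le)
    fix v v' L assume v: "v \<in> I" "v' \<in> I" "L \<in> D v" "L \<in> D v'"
    then have "fst v = fst v'"
      using latin_row_eq[OF F_latin elems(1), of L "fst v" "fst v'"] by (auto simp: D_def H_def N1_def I_def)
    then show "v = v'" using v by (auto simp: D_def H_def prod_eq_iff)
  next
    fix v assume "v \<in> I"
    then have v: "fst v \<in> U - C" by (auto simp: I_def)
    show "D v \<subseteq> N3"
    proof
      fix L assume "L \<in> D v"
      then have "L \<in> F" "\<exists>a\<in>U - R. L a c = s" "L r (fst v) = s" "\<exists>b\<in>U - R. L b (fst v) = L r c"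
        by (auto simp: D_def H_def N1_def)
      then show "L \<in> N3" unfolding N3_def using v by blast
    qed
  qed (use finI finite_sets in auto)
  have "N2 \<subseteq> N3 \<union> (\<Union>i\<in>R - {r}. \<Union>v\<in>I. B i v)"
  proof
    fix L assume L: "L \<in> N2"
    then obtain e where e: "L \<in> N1" "L \<in> F" "e \<in> U" "e \<notin> C" "L r e = s" by (auto simp: N2_def N1_def)
    have l: "latin L" using F_latin e by simp
    have wU: "L r c \<in> U" using latin_mem[OF l elems] .
    define b where "b = row_with L e (L r c)"
    have b: "b \<in> U" "L b e = L r c" using row_with[OF l e(3) wU] by (auto simp: b_def)
    have "b \<noteq> r" using b latin_row_eq[OF l elems(1) e(3) elems(2)] e cC by auto
    show "L \<in> N3 \<union> (\<Union>i\<in>R - {r}. \<Union>v\<in>I. B i v)"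
    proof (cases "b \<in> R")
      case True
      then have "L \<in> B b (e, L r c)" "(e, L r c) \<in> I" "b \<in> R - {r}"
        using b e wU \<open>b \<noteq> r\<close> by (auto simp: B_def H_def I_def)
      then show ?thesis by blast
    next
      case False
      have "\<exists>a\<in>U - R. L a c = s" using e(1) by (simp add: N1_def)
      then have "L \<in> N3" using e b False unfolding N3_def by blast
      then show ?thesis by blast
    qed
  qed
  then have "card N2 \<le> card (N3 \<union> (\<Union>i\<in>R - {r}. \<Union>v\<in>I. B i v))"
    using finite_sets finite_RC finB finI by (intro card_mono) auto
  also have "\<dots> \<le> card N3 + card (\<Union>i\<in>R - {r}. \<Union>v\<in>I. B i v)" by (rule card_Un_le)
  also have "card (\<Union>i\<in>R - {r}. \<Union>v\<in>I. B i v) \<le> (\<Sum>i\<in>R - {r}. \<Sum>v\<in>I. card (B i v))"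
    by (rule le_trans[OF card_UN_le]) (use finite_RC finI in \<open>auto intro: sum_mono card_UN_le\<close>)
  finally have "card N2 \<le> card N3 + (\<Sum>i\<in>R - {r}. \<Sum>v\<in>I. card (B i v))" by simp
  from mult_le_mono2[OF this, of "G * G"]
  have "G * G * card N2 \<le> G * G * card N3 + (\<Sum>i\<in>R - {r}. \<Sum>v\<in>I. G * G * card (B i v))"
    by (simp add: distrib_left sum_distrib_left)
  also have "(\<Sum>i\<in>R - {r}. \<Sum>v\<in>I. G * G * card (B i v)) \<le> (\<Sum>i\<in>R - {r}. \<Sum>v\<in>I. cost * card (D v))"
    by (intro sum_mono bound)
  also have "\<dots> = card (R - {r}) * (cost * (\<Sum>v\<in>I. card (D v)))" by (simp add: sum_distrib_left)
  also have "\<dots> \<le> card R * (cost * card N3)"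
    using card_mono[OF finite_RC(1), of "R - {r}"] D by (intro mult_le_mono) auto
  finally show ?thesis by (simp add: algebra_simps)
qed

end

section \<open>Probability bounds\<close>

text \<open>The explicit constants. The factor \<open>1 + 17 / slack\<close> is the loss in a single switching, caused by intercalates.\<close>
definition slack :: "real \<Rightarrow> real \<Rightarrow> real" where
  "slack \<alpha> \<beta> = 1 - 2 * \<alpha> - \<beta>"

definition upper_const :: "real \<Rightarrow> real \<Rightarrow> real" where
  "upper_const \<alpha> \<beta> = (1 + 17 / slack \<alpha> \<beta>) / slack \<alpha> \<beta>"

definition lower_const :: "real \<Rightarrow> real \<Rightarrow> real" where
  "lower_const \<alpha> \<beta> = 1 + (1 + \<alpha> * upper_const \<alpha> \<beta>)\<^sup>2 * (1 + \<beta> * upper_const \<alpha> \<beta>) * (1 + 17 / slack \<alpha> \<beta>)"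

context open_entry begin

text \<open>The counting inequalities divided by \<open>G\<^sup>2\<close>, with \<open>G \<ge> \<gamma> n\<close>. In particular \<open>cost / G\<^sup>2 \<le> upper_const \<alpha> \<beta> / n\<close>, so the
  three restrictions in the lower bound cost factors close to 1 for small \<open>\<alpha>\<close> and \<open>\<beta>\<close>.\<close>
lemma entry_bounds:
  fixes \<alpha> \<beta> :: real
  assumes ab: "\<alpha> > 0" "\<beta> > 0" "2 * \<alpha> + \<beta> < 1"
    and G': "slack \<alpha> \<beta> * card U \<le> G"
    and R: "card R \<le> \<alpha> * card U" and C: "card C \<le> \<beta> * card U"
  shows "card E \<le> upper_const \<alpha> \<beta> / card U * card F"
    and "card F \<le> lower_const \<alpha> \<beta> * card U * card E"
proof -
  define n g \<gamma> K where "n = real (card U)" and "g = real G" and "\<gamma> = slack \<alpha> \<beta>" and "K = upper_const \<alpha> \<beta>"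
  have n: "n \<ge> 1" using elems fin by (auto simp: n_def Suc_le_eq card_gt_0_iff)
  have \<gamma>: "\<gamma> > 0" using ab by (simp add: \<gamma>_def slack_def)
  have gn: "\<gamma> * n \<le> g" using G' by (simp add: \<gamma>_def n_def g_def)
  moreover have "0 < \<gamma> * n" using n \<gamma> by simp
  ultimately have g: "g > 0" by linarith
  have A: "real cost = g + 17 * n" by (simp add: cost_def g_def n_def)
  have ng: "n / g \<le> 1 / \<gamma>" using gn g \<gamma> by (simp add: field_simps)
  have Ag: "cost / g \<le> 1 + 17 / \<gamma>" using ng g by (simp add: A add_divide_distrib)
  have "cost / (g * g) = cost / g * (1 / g)" by simp
  also have "\<dots> \<le> (1 + 17 / \<gamma>) * (1 / (\<gamma> * n))"
    using Ag gn g \<gamma> n by (intro mult_mono) (auto simp: frac_le)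
  also have "\<dots> = K / n" by (simp add: K_def upper_const_def \<gamma>_def)
  finally have \<rho>: "cost / (g * g) \<le> K / n" .
  have K: "K > 0" using \<gamma> by (simp add: K_def upper_const_def \<gamma>_def add_pos_pos)
  have le_div: "x \<le> y / (g * g)" if "g * g * x \<le> y" for x y :: real
    using that g by (simp add: pos_le_divide_eq mult.commute)
  have step: "x \<le> (1 + \<theta> * K) * y"
    if "G * G * x' \<le> (G * G + m * cost) * y'" "real m \<le> \<theta> * n" "x = real x'" "y = real y'" for x y \<theta> :: real and x' y' m :: nat
  proof -
    have "real (G * G * x') \<le> real ((G * G + m * cost) * y')" using that(1) by (simp only: of_nat_le_iff)
    then have "g * g * x \<le> (g * g + m * real cost) * y" by (simp add: g_def that(3,4))
    then have "x \<le> (g * g + m * real cost) * y / (g * g)" by (rule le_div)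
    also have "\<dots> = (1 + m * (cost / (g * g))) * y" using g by (simp add: field_simps)
    also have "m * (cost / (g * g)) \<le> (\<theta> * n) * (K / n)"
      using that(2) \<rho> g K n by (intro mult_mono) auto
    also have "(\<theta> * n) * (K / n) = \<theta> * K" using n by simp
    finally show ?thesis using that(4) by (simp add: mult_right_mono)
  qed
  have "real (G * G * card E) \<le> real (cost * card F)" using cell_E by (simp only: of_nat_le_iff)
  then have "g * g * card E \<le> cost * card F" by (simp add: g_def)
  then have "card E \<le> cost * card F / (g * g)" by (rule le_div)
  also have "\<dots> = cost / (g * g) * card F" by simp
  also have "\<dots> \<le> K / n * card F" using \<rho> by (intro mult_right_mono) auto
  finally show "card E \<le> upper_const \<alpha> \<beta> / card U * card F" by (simp add: K_def n_def)
  have "real (G * card N3) \<le> real (cost * card U * card E)" using card_N3 by (simp only: of_nat_le_iff)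
  then have "g * card N3 \<le> cost * n * card E" by (simp add: g_def n_def)
  then have "card N3 \<le> cost * n * card E / g" using g by (simp add: pos_le_divide_eq mult.commute)
  also have "\<dots> = cost / g * (n * card E)" by simp
  also have "\<dots> \<le> (1 + 17 / \<gamma>) * (n * card E)" using Ag n by (intro mult_right_mono) auto
  finally have 3: "card N3 \<le> (1 + 17 / \<gamma>) * (n * card E)" .
  have Rn: "card R \<le> \<alpha> * n" and Cn: "card C \<le> \<beta> * n" using R C by (auto simp: n_def)
  have pos: "0 \<le> 1 + \<alpha> * K" "0 \<le> 1 + \<beta> * K" using ab K by (auto intro: add_nonneg_nonneg)
  have N2: "card N2 \<le> (1 + \<alpha> * K) * card N3" by (rule step[OF card_N2 Rn refl refl])
  have "card N1 \<le> (1 + \<beta> * K) * card N2" by (rule step[OF card_N1 Cn refl refl])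
  also have "\<dots> \<le> (1 + \<beta> * K) * ((1 + \<alpha> * K) * card N3)" using N2 pos by (intro mult_left_mono)
  finally have N1: "card N1 \<le> (1 + \<beta> * K) * ((1 + \<alpha> * K) * card N3)" .
  have "G * G * (card F - card E) \<le> (G * G + card R * cost) * card N1"
    using card_F by (simp add: diff_mult_distrib2)
  from step[OF this Rn refl refl]
  have "real (card F - card E) \<le> (1 + \<alpha> * K) * card N1" .
  then have "card F \<le> card E + (1 + \<alpha> * K) * card N1" by (simp add: of_nat_diff_if split: if_splits)
  also have "\<dots> \<le> card E + (1 + \<alpha> * K) * ((1 + \<beta> * K) * ((1 + \<alpha> * K) * ((1 + 17 / \<gamma>) * (n * card E))))"
    using N1 3 pos by (intro add_left_mono mult_left_mono order.trans[OF N1]) auto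
  also have "\<dots> = card E + (lower_const \<alpha> \<beta> - 1) * (n * card E)"
  proof -
    have "lower_const \<alpha> \<beta> - 1 = (1 + \<alpha> * K)\<^sup>2 * (1 + \<beta> * K) * (1 + 17 / \<gamma>)"
      by (simp add: lower_const_def K_def \<gamma>_def)
    then show ?thesis by (simp only: power2_eq_square ac_simps)
  qed
  \<comment> \<open>\<open>card E\<close> itself is bounded crudely by \<open>n * card E\<close>; this is the summand 1 in \<open>lower_const\<close>\<close>
  also have "\<dots> \<le> n * card E + (lower_const \<alpha> \<beta> - 1) * (n * card E)"
    using n by (intro add_right_mono) (simp add: mult_left_le_one_le mult_le_cancel_right1)
  also have "\<dots> = lower_const \<alpha> \<beta> * n * card E" by (simp add: algebra_simps)
  finally show "card F \<le> lower_const \<alpha> \<beta> * card U * card E" by (simp add: n_def)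
qed

end

context index_set begin

lemma completions_bounds:
  fixes \<alpha> \<beta> :: real
  assumes ab: "\<alpha> > 0" "\<beta> > 0" "2 * \<alpha> + \<beta> < 1"
    and P: "P \<subseteq> U \<times> U \<times> U"
    and cell: "\<And>i j k k'. (i, j, k) \<in> P \<Longrightarrow> (i, j, k') \<in> P \<Longrightarrow> k = k'"
    and row: "\<And>i j j' k. (i, j, k) \<in> P \<Longrightarrow> (i, j', k) \<in> P \<Longrightarrow> j = j'"
    and col: "\<And>i i' j k. (i, j, k) \<in> P \<Longrightarrow> (i', j, k) \<in> P \<Longrightarrow> i = i'"
    and R: "card (fst ` P) \<le> \<alpha> * card U" and C: "card ((fst \<circ> snd) ` P) \<le> \<beta> * card U"
  shows "card (completions P) \<le> (upper_const \<alpha> \<beta> / card U) ^ card P * card (completions {})"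
    and "card (completions {}) \<le> (lower_const \<alpha> \<beta> * card U) ^ card P * card (completions P)"
proof -
  define R' C' where "R' = fst ` P" and "C' = (fst \<circ> snd) ` P"
  define G where "G = card U - (card C' + 2 * card R')"
  have "real (card C' + 2 * card R') \<le> (2 * \<alpha> + \<beta>) * card U" using R C by (simp add: R'_def C'_def algebra_simps)
  also have "\<dots> \<le> 1 * real (card U)" using ab by (intro mult_right_mono) auto
  finally have le: "card C' + 2 * card R' \<le> card U" by linarith
  then have Gr: "real G = card U - card C' - 2 * card R'" by (simp add: G_def of_nat_diff)
  have G': "slack \<alpha> \<beta> * card U \<le> G" using R C by (simp add: Gr slack_def R'_def C'_def algebra_simps)
  have K: "upper_const \<alpha> \<beta> \<ge> 0" "lower_const \<alpha> \<beta> \<ge> 0"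
    using ab by (auto simp: upper_const_def lower_const_def slack_def intro!: add_nonneg_nonneg mult_nonneg_nonneg divide_nonneg_nonneg)
  have finP: "finite P" using P fin by (meson finite_SigmaI finite_subset)
  have "card (completions Q) \<le> (upper_const \<alpha> \<beta> / card U) ^ card Q * card (completions {}) \<and>
      card (completions {}) \<le> (lower_const \<alpha> \<beta> * card U) ^ card Q * card (completions Q)" if "Q \<subseteq> P" for Q
    using finite_subset[OF that finP] that
  proof (induction Q rule: finite_induct)
    case empty
    then show ?case by simp
  next
    case (insert v Q)
    obtain r c s where v: "v = (r, c, s)" by (cases v)
    have vP: "(r, c, s) \<in> P" and QP: "Q \<subseteq> P" using insert.prems v by auto
    interpret e: open_entry U R' C' Q r c s G
    proof unfold_locales
      show "R' \<subseteq> U" "C' \<subseteq> U" using P by (auto simp: R'_def C'_def)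
      show "r \<in> R'" "c \<in> C'" using vP by (force simp: R'_def C'_def)+
      show "s \<in> U" using vP P by auto
      show "(i, j, k) \<in> Q \<Longrightarrow> i \<in> R' \<and> j \<in> C'" for i j k using QP by (force simp: R'_def C'_def)
      show "(r, c, k) \<notin> Q" for k using cell[OF vP, of k] QP insert.hyps(2) v by blast
      show "(r, j, s) \<notin> Q" for j using row[OF vP, of j] QP insert.hyps(2) v by blast
      show "(i, c, s) \<notin> Q" for i using col[OF vP, of i] QP insert.hyps(2) v by blast
      show "G + card C' + 2 * card R' \<le> card U" using le by (simp add: G_def)
    qed
    have E: "e.E = completions (insert v Q)" by (auto simp: e.E_def e.F_def completions_def v)
    note b = e.entry_bounds[OF ab G' R[folded R'_def] C[folded C'_def], unfolded E, unfolded e.F_def]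
    note IH = insert.IH[OF QP]
    have "card (completions (insert v Q)) \<le> upper_const \<alpha> \<beta> / card U * card (completions Q)" by (rule b(1))
    also have "\<dots> \<le> upper_const \<alpha> \<beta> / card U * ((upper_const \<alpha> \<beta> / card U) ^ card Q * card (completions {}))"
      using IH K by (intro mult_left_mono) auto
    finally have 1: "card (completions (insert v Q)) \<le> (upper_const \<alpha> \<beta> / card U) ^ card (insert v Q) * card (completions {})"
      using insert.hyps by (simp add: mult_ac)
    have "card (completions {}) \<le> (lower_const \<alpha> \<beta> * card U) ^ card Q * card (completions Q)" using IH by blast
    also have "\<dots> \<le> (lower_const \<alpha> \<beta> * card U) ^ card Q * (lower_const \<alpha> \<beta> * card U * card (completions (insert v Q)))"
      using b(2) K by (intro mult_left_mono) auto
    finally have 2: "card (completions {}) \<le> (lower_const \<alpha> \<beta> * card U) ^ card (insert v Q) * card (completions (insert v Q))"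
      using insert.hyps by (simp add: mult_ac)
    show ?case using 1 2 by blast
  qed
  from this[of P] show "card (completions P) \<le> (upper_const \<alpha> \<beta> / card U) ^ card P * card (completions {})"
    and "card (completions {}) \<le> (lower_const \<alpha> \<beta> * card U) ^ card P * card (completions P)" by auto
qed

end

text \<open>The translation from matrices back to sets of entries.\<close>
definition entries :: "nat \<Rightarrow> (nat \<Rightarrow> nat \<Rightarrow> nat) \<Rightarrow> entry set" where
  "entries n f = {(i, j, f i j) | i j. i \<in> {1..n} \<and> j \<in> {1..n}}"

lemma entries_iff: "(i, j, k) \<in> entries n f \<longleftrightarrow> i \<in> {1..n} \<and> j \<in> {1..n} \<and> k = f i j"
  by (auto simp: entries_def)

lemma card_completions:
  assumes Q: "Q \<subseteq> {1..n} \<times> {1..n} \<times> {1..n}"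
  shows "card (index_set.completions {1..n} Q) = card {L. latin_square n L \<and> Q \<subseteq> L}"
proof -
  interpret index_set "{1..n}" by unfold_locales simp
  have "bij_betw (entries n) (completions Q) {L. latin_square n L \<and> Q \<subseteq> L}"
  proof (rule bij_betwI')
    fix f g assume fg: "f \<in> completions Q" "g \<in> completions Q"
    show "entries n f = entries n g \<longleftrightarrow> f = g"
    proof
      assume eq: "entries n f = entries n g"
      show "f = g"
      proof (intro ext)
        fix i j
        show "f i j = g i j"
        proof (cases "i \<in> {1..n} \<and> j \<in> {1..n}")
          case True
          then have "(i, j, f i j) \<in> entries n g" unfolding eq[symmetric] by (simp add: entries_iff)
          then show ?thesis by (simp add: entries_iff)
        next
          case False
          then show ?thesis using fg unfolding completions_def latin_def by auto
        qed
      qed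
    qed simp
  next
    fix f assume f: "f \<in> completions Q"
    then have l: "latin f" unfolding completions_def by blast
    have "v \<in> entries n f" if v: "v \<in> Q" for v
    proof -
      obtain i j k where ijk: "v = (i, j, k)" by (cases v)
      have "\<forall>(i, j, k)\<in>Q. f i j = k" using f unfolding completions_def mem_Collect_eq by (rule conjunct2)
      then have "f i j = k" using bspec[OF _ v] by (auto simp: ijk)
      moreover have "i \<in> {1..n} \<and> j \<in> {1..n} \<and> k \<in> {1..n}" using subsetD[OF Q v] unfolding ijk mem_Sigma_iff .
      ultimately show ?thesis unfolding ijk entries_iff by blast
    qed
    then have "Q \<subseteq> entries n f" by blast
    moreover have "latin_square n (entries n f)"
      unfolding latin_square_def partial_latin_square_def
    proof (intro conjI allI impI ballI)
      show "entries n f \<subseteq> {1..n} \<times> {1..n} \<times> {1..n}" using latin_mem[OF l] unfolding entries_def by blast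
    next
      fix r c s s' assume "(r, c, s) \<in> entries n f" "(r, c, s') \<in> entries n f"
      then show "s = s'" by (simp add: entries_iff)
    next
      fix r c c' s assume "(r, c, s) \<in> entries n f" "(r, c', s) \<in> entries n f"
      then show "c = c'" using latin_row_eq[OF l, of r c c'] by (simp add: entries_iff)
    next
      fix r r' c s assume "(r, c, s) \<in> entries n f" "(r', c, s) \<in> entries n f"
      then show "r = r'" using latin_col_eq[OF l, of c r r'] by (simp add: entries_iff)
    next
      fix r c assume "r \<in> {1..n}" "c \<in> {1..n}"
      then show "\<exists>s. (r, c, s) \<in> entries n f" by (simp add: entries_iff)
    qed
    ultimately show "entries n f \<in> {L. latin_square n L \<and> Q \<subseteq> L}" by simp
  next
    fix L assume "L \<in> {L. latin_square n L \<and> Q \<subseteq> L}"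
    then have ls: "latin_square n L" and QL: "Q \<subseteq> L" by simp_all
    note sq = ls[unfolded latin_square_def partial_latin_square_def]
    note sub = sq[THEN conjunct1, THEN conjunct1]
      and cell' = sq[THEN conjunct1, THEN conjunct2, THEN conjunct1]
      and row' = sq[THEN conjunct1, THEN conjunct2, THEN conjunct2, THEN conjunct1]
      and col' = sq[THEN conjunct1, THEN conjunct2, THEN conjunct2, THEN conjunct2]
      and full' = sq[THEN conjunct2]
    have cell: "(r, c, s) \<in> L \<Longrightarrow> (r, c, s') \<in> L \<Longrightarrow> s = s'" for r c s s' using cell' by blast
    have row: "(r, c, s) \<in> L \<Longrightarrow> (r, c', s) \<in> L \<Longrightarrow> c = c'" for r c c' s using row' by blast
    have col: "(r, c, s) \<in> L \<Longrightarrow> (r', c, s) \<in> L \<Longrightarrow> r = r'" for r r' c s using col' by blast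
    have full: "r \<in> {1..n} \<Longrightarrow> c \<in> {1..n} \<Longrightarrow> \<exists>s. (r, c, s) \<in> L" for r c using full' by blast
    define f where "f i j = (if i \<in> {1..n} \<and> j \<in> {1..n} then THE s. (i, j, s) \<in> L else 0)" for i j
    have fL: "(i, j, f i j) \<in> L" if "i \<in> {1..n}" "j \<in> {1..n}" for i j
    proof -
      have "\<exists>!s. (i, j, s) \<in> L" using full[OF that] cell by blast
      then show ?thesis using theI'[of "\<lambda>s. (i, j, s) \<in> L"] that by (simp add: f_def)
    qed
    have feq: "f i j = k" if "(i, j, k) \<in> L" for i j k
      using cell[OF fL that] sub that by blast
    have "latin f"
      unfolding latin_def line_iff
    proof (intro conjI ballI allI impI)
      fix i assume i: "i \<in> {1..n}"
      show "inj_on (f i) {1..n}" using row fL[OF i] by (intro inj_onI) metis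
      show "f i ` {1..n} \<subseteq> {1..n}" using fL[OF i] sub by blast
    next
      fix j assume j: "j \<in> {1..n}"
      show "inj_on (\<lambda>i. f i j) {1..n}" using col fL[OF _ j] by (intro inj_onI) metis
      show "(\<lambda>i. f i j) ` {1..n} \<subseteq> {1..n}" using fL[OF _ j] sub by blast
    next
      fix i j assume "i \<notin> {1..n} \<or> j \<notin> {1..n}"
      then show "f i j = 0" by (auto simp: f_def)
    qed
    then have "f \<in> completions Q" using feq QL unfolding completions_def by auto
    moreover have "L = entries n f"
    proof (intro set_eqI)
      fix v :: entry
      obtain i j k where v: "v = (i, j, k)" by (cases v)
      have "(i, j, k) \<in> L \<Longrightarrow> i \<in> {1..n} \<and> j \<in> {1..n}" using sub by blast
      then show "v \<in> L \<longleftrightarrow> v \<in> entries n f" unfolding v entries_iff using feq fL by blast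
    qed
    ultimately show "\<exists>f\<in>completions Q. L = entries n f" by blast
  qed
  then show ?thesis by (rule bij_betw_same_card)
qed

lemma slack_tendsto:
  "((\<lambda>p. slack (fst p) (snd p)) \<longlongrightarrow> 1) (at (0, 0) within S)"
  unfolding slack_def by (auto intro!: tendsto_eq_intros)

lemma upper_const_tendsto:
  "((\<lambda>p. upper_const (fst p) (snd p)) \<longlongrightarrow> 18) (at (0, 0) within S)"
  unfolding upper_const_def by (rule tendsto_eq_intros slack_tendsto refl | simp)+

lemma lower_const_tendsto:
  "((\<lambda>p. lower_const (fst p) (snd p)) \<longlongrightarrow> 19) (at (0, 0) within S)"
  unfolding lower_const_def by (rule tendsto_eq_intros slack_tendsto upper_const_tendsto refl | simp)+

lemma rows_cols_image: "rows_of P = fst ` P" "cols_of P = (fst \<circ> snd) ` P"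
  by (force simp: rows_of_def cols_of_def)+

lemma consts_pos:
  assumes "\<alpha> > 0" "\<beta> > 0" "2 * \<alpha> + \<beta> < 1"
  shows "upper_const \<alpha> \<beta> > 0" "lower_const \<alpha> \<beta> > 0"
proof -
  have s: "slack \<alpha> \<beta> > 0" using assms by (simp add: slack_def)
  then show K: "upper_const \<alpha> \<beta> > 0" by (simp add: upper_const_def add_pos_pos)
  have "1 + \<alpha> * upper_const \<alpha> \<beta> > 0" "1 + \<beta> * upper_const \<alpha> \<beta> > 0" "1 + 17 / slack \<alpha> \<beta> > 0"
    using assms K s by (auto intro: add_pos_pos)
  then show "lower_const \<alpha> \<beta> > 0" by (simp add: lower_const_def add_pos_pos)
qed

lemma containment_prob_bounds:
  fixes \<alpha> \<beta> :: real
  assumes ab: "\<alpha> > 0" "\<beta> > 0" "2 * \<alpha> + \<beta> < 1" and n: "n > 0" and P: "partial_latin_square n P"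
    and R: "card (rows_of P) \<le> \<alpha> * n" and C: "card (cols_of P) \<le> \<beta> * n"
  shows "(1 / lower_const \<alpha> \<beta> / n) ^ card P \<le> measure_pmf.prob (random_latin_square n) {L. P \<subseteq> L}"
    and "measure_pmf.prob (random_latin_square n) {L. P \<subseteq> L} \<le> (upper_const \<alpha> \<beta> / n) ^ card P"
proof -
  interpret index_set "{1..n}" by unfold_locales simp
  define N NP where "N = real (card (completions {}))" and "NP = real (card (completions P))"
  note sq = P[unfolded partial_latin_square_def]
  note sub = sq[THEN conjunct1] and cell' = sq[THEN conjunct2, THEN conjunct1]
    and row' = sq[THEN conjunct2, THEN conjunct2, THEN conjunct1] and col' = sq[THEN conjunct2, THEN conjunct2, THEN conjunct2]
  have "card {L. latin_square n L} > 0"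
    using finite_latin_squares latin_squares_nonempty by (simp only: card_gt_0_iff) simp
  moreover have N: "card (completions {}) = card {L. latin_square n L}" using card_completions[of "{}" n] by simp
  ultimately have pos: "N > 0" by (simp add: N_def)
  have "measure_pmf.prob (random_latin_square n) {L. P \<subseteq> L} =
      card ({L. latin_square n L} \<inter> {L. P \<subseteq> L}) / card {L. latin_square n L}"
    unfolding random_latin_square_def
    by (rule measure_pmf_of_set[OF latin_squares_nonempty finite_latin_squares])
  also have "{L. latin_square n L} \<inter> {L. P \<subseteq> L} = {L. latin_square n L \<and> P \<subseteq> L}" by blast
  finally have prob: "measure_pmf.prob (random_latin_square n) {L. P \<subseteq> L} = NP / N"
    using card_completions[OF sub] N by (simp add: N_def NP_def)
  have cell: "(i, j, k) \<in> P \<Longrightarrow> (i, j, k') \<in> P \<Longrightarrow> k = k'" for i j k k' using cell' by blast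
  have row: "(i, j, k) \<in> P \<Longrightarrow> (i, j', k) \<in> P \<Longrightarrow> j = j'" for i j j' k using row' by blast
  have col: "(i, j, k) \<in> P \<Longrightarrow> (i', j, k) \<in> P \<Longrightarrow> i = i'" for i i' j k using col' by blast
  have RC: "real (card (fst ` P)) \<le> \<alpha> * real (card {1..n})" "real (card ((fst \<circ> snd) ` P)) \<le> \<beta> * real (card {1..n})"
    using R C by (simp_all add: rows_cols_image)
  have b: "NP \<le> (upper_const \<alpha> \<beta> / n) ^ card P * N" "N \<le> (lower_const \<alpha> \<beta> * n) ^ card P * NP"
    using completions_bounds(1)[OF ab sub cell row col RC] completions_bounds(2)[OF ab sub cell row col RC]
    unfolding N_def NP_def by simp_all
  show "measure_pmf.prob (random_latin_square n) {L. P \<subseteq> L} \<le> (upper_const \<alpha> \<beta> / n) ^ card P"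
    unfolding prob using b(1) pos by (simp add: pos_divide_le_eq)
  have D: "(lower_const \<alpha> \<beta> * n) ^ card P > 0" using consts_pos(2)[OF ab] n by simp
  have "1 / lower_const \<alpha> \<beta> / n = 1 / (lower_const \<alpha> \<beta> * n)" by simp
  then have "(1 / lower_const \<alpha> \<beta> / n) ^ card P = 1 / (lower_const \<alpha> \<beta> * n) ^ card P" by (simp add: power_one_over)
  also have "\<dots> \<le> NP / N" using b(2) pos D by (simp add: field_simps)
  finally show "(1 / lower_const \<alpha> \<beta> / n) ^ card P \<le> measure_pmf.prob (random_latin_square n) {L. P \<subseteq> L}"
    unfolding prob .
qed

text \<open>The constants \<open>18\<close> and \<open>19\<close> are scaled to \<open>23\<close>, which weakens both bounds.\<close>
theorem theorem1p1:
  shows "\<exists>\<delta> \<Delta> :: real \<Rightarrow> real \<Rightarrow> real.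
    (\<forall>\<alpha> \<beta>. \<alpha> > 0 \<longrightarrow> \<beta> > 0 \<longrightarrow> 2 * \<alpha> + \<beta> < 1 \<longrightarrow> \<delta> \<alpha> \<beta> > 0 \<and> \<Delta> \<alpha> \<beta> > 0) \<and>
    ((\<lambda>(\<alpha>, \<beta>). \<delta> \<alpha> \<beta>) \<longlongrightarrow> 1 / 23)
      (at (0, 0) within {(\<alpha>, \<beta>). \<alpha> > 0 \<and> \<beta> > 0 \<and> 2 * \<alpha> + \<beta> < 1}) \<and>
    ((\<lambda>(\<alpha>, \<beta>). \<Delta> \<alpha> \<beta>) \<longlongrightarrow> 23)
      (at (0, 0) within {(\<alpha>, \<beta>). \<alpha> > 0 \<and> \<beta> > 0 \<and> 2 * \<alpha> + \<beta> < 1}) \<and>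
    (\<forall>(\<alpha> :: real) (\<beta> :: real) (n :: nat) (P :: entry set).
       \<alpha> > 0 \<longrightarrow> \<beta> > 0 \<longrightarrow> 2 * \<alpha> + \<beta> < 1 \<longrightarrow> n > 0 \<longrightarrow>
       partial_latin_square n P \<longrightarrow>
       real (card (rows_of P)) \<le> \<alpha> * real n \<longrightarrow>
       real (card (cols_of P)) \<le> \<beta> * real n \<longrightarrow>
       (\<delta> \<alpha> \<beta> / real n) ^ card P \<le> measure_pmf.prob (random_latin_square n) {L. P \<subseteq> L} \<and>
       measure_pmf.prob (random_latin_square n) {L. P \<subseteq> L} \<le> (\<Delta> \<alpha> \<beta> / real n) ^ card P)"
proof (intro exI conjI allI impI)
  let ?\<delta> = "\<lambda>\<alpha> \<beta>. 19 / 23 / lower_const \<alpha> \<beta>" and ?\<Delta> = "\<lambda>\<alpha> \<beta>. 23 / 18 * upper_const \<alpha> \<beta>"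
  let ?S = "{(\<alpha>, \<beta>). \<alpha> > 0 \<and> \<beta> > 0 \<and> 2 * \<alpha> + \<beta> < (1 :: real)}"
  show "((\<lambda>(\<alpha>, \<beta>). ?\<delta> \<alpha> \<beta>) \<longlongrightarrow> 1 / 23) (at (0, 0) within ?S)"
    unfolding case_prod_beta by (rule tendsto_eq_intros lower_const_tendsto refl | simp)+
  show "((\<lambda>(\<alpha>, \<beta>). ?\<Delta> \<alpha> \<beta>) \<longlongrightarrow> 23) (at (0, 0) within ?S)"
    unfolding case_prod_beta by (rule tendsto_eq_intros upper_const_tendsto refl | simp)+
  fix \<alpha> \<beta> :: real
  assume ab: "\<alpha> > 0" "\<beta> > 0" "2 * \<alpha> + \<beta> < 1"
  note pos = consts_pos[OF ab]
  show "?\<delta> \<alpha> \<beta> > 0" "?\<Delta> \<alpha> \<beta> > 0" using pos by simp_all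
  fix n :: nat and P :: "entry set"
  assume P: "n > 0" "partial_latin_square n P" "real (card (rows_of P)) \<le> \<alpha> * real n" "real (card (cols_of P)) \<le> \<beta> * real n"
  note bounds = containment_prob_bounds[OF ab P]
  have "(?\<delta> \<alpha> \<beta> / n) ^ card P \<le> (1 / lower_const \<alpha> \<beta> / n) ^ card P"
    using pos by (intro power_mono divide_right_mono) auto
  then show "(?\<delta> \<alpha> \<beta> / n) ^ card P \<le> measure_pmf.prob (random_latin_square n) {L. P \<subseteq> L}"
    using bounds(1) by linarith
  have "(upper_const \<alpha> \<beta> / n) ^ card P \<le> (?\<Delta> \<alpha> \<beta> / n) ^ card P"
    using pos by (intro power_mono divide_right_mono) auto
  then show "measure_pmf.prob (random_latin_square n) {L. P \<subseteq> L} \<le> (?\<Delta> \<alpha> \<beta> / n) ^ card P"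
    using bounds(2) by linarith
qed

end
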